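(* Let $H$ be a graph with $\chi(H)=3$ such that (i) exactly one connected component of $H$ has chromatic number $3$, and (ii) every connected component of $H$ has at least $\sigma(H)$ vertices. Then $f(H,P_5)=R_3(H)$.
   Context: For a $k$-chromatic graph $G$, the chromatic surplus $\sigma(G)$ is the minimum, over all proper $k$-vertex-colorings of $G$, of the minimum size of a color class. $P_5$ is the path on $5$ vertices. Monochromatic: all edges same color; rainbow: all edges distinct colors. $f(H,G)$ is the minimum $n$ such that every edge-coloring of $K_n$ with any number of colors contains a monochromatic copy of $H$ or a rainbow copy of $G$. $R_3(H)$ is the minimum $n$ such that every coloring of $E(K_n)$ with colors from $\{1,2,3\}$ (not all need be used) contains a monochromatic $H$. *)

theory Defs
  imports "HOL-Library.Ramsey"
begin

datatype 'a graph = Graph (verts: "'a set") (edges: "'a set set")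

definition simple_graph :: "'a graph \<Rightarrow> bool" where
  "simple_graph G \<longleftrightarrow> finite (verts G) \<and> edges G \<subseteq> [verts G]\<^bsup>2\<^esup>"

definition complete_graph :: "nat \<Rightarrow> nat graph" where
  "complete_graph n = Graph {..<n} ([{..<n}]\<^bsup>2\<^esup>)"

definition path_graph :: "nat \<Rightarrow> nat graph" where
  "path_graph n = Graph {..<n} {{i, Suc i} | i. Suc i < n}"

definition subgraph :: "'a graph \<Rightarrow> 'a graph \<Rightarrow> bool" where
  "subgraph F G \<longleftrightarrow> simple_graph F \<and> verts F \<subseteq> verts G \<and> edges F \<subseteq> edges G"

definition isomorphic :: "'a graph \<Rightarrow> 'b graph \<Rightarrow> bool" where
  "isomorphic F G \<longleftrightarrow>
     (\<exists>\<phi>. bij_betw \<phi> (verts F) (verts G) \<and> edges G = (\<lambda>e. \<phi> ` e) ` edges F)"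

definition copy_in :: "'a graph \<Rightarrow> 'b graph \<Rightarrow> 'b graph \<Rightarrow> bool" where
  "copy_in H F G \<longleftrightarrow> subgraph F G \<and> isomorphic H F"

definition induced_subgraph :: "'a graph \<Rightarrow> 'a set \<Rightarrow> 'a graph" where
  "induced_subgraph G S = Graph S {e \<in> edges G. e \<subseteq> S}"

definition adjacency :: "'a graph \<Rightarrow> ('a \<times> 'a) set" where
  "adjacency G = {(u, v). {u, v} \<in> edges G}"

definition components :: "'a graph \<Rightarrow> 'a graph set" where
  "components G = (\<lambda>v. induced_subgraph G ((adjacency G)\<^sup>* `` {v})) ` verts G"

definition proper_coloring :: "'a graph \<Rightarrow> nat \<Rightarrow> ('a \<Rightarrow> nat) \<Rightarrow> bool" where
  "proper_coloring G k c \<longleftrightarrow>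
     c ` verts G \<subseteq> {..<k} \<and> (\<forall>u v. {u, v} \<in> edges G \<longrightarrow> c u \<noteq> c v)"

definition chromatic_number :: "'a graph \<Rightarrow> nat" where
  "chromatic_number G = (LEAST k. \<exists>c. proper_coloring G k c)"

definition color_class :: "'a graph \<Rightarrow> ('a \<Rightarrow> nat) \<Rightarrow> nat \<Rightarrow> 'a set" where
  "color_class G c i = {v \<in> verts G. c v = i}"

text \<open>With exactly as many colours as the chromatic number, every colour class of a
  proper colouring is nonempty, so the inner minimum never sees an unused colour.\<close>

definition chromatic_surplus :: "'a graph \<Rightarrow> nat" where
  "chromatic_surplus G =
     (LEAST s. \<exists>c. proper_coloring G (chromatic_number G) c \<and>
        s = Min ((\<lambda>i. card (color_class G c i)) ` {..<chromatic_number G}))"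

text \<open>An edge-colouring of a graph is a total function on vertex sets of which only the values
  on edges matter.\<close>

definition monochromatic_graph :: "('a set \<Rightarrow> nat) \<Rightarrow> 'a graph \<Rightarrow> bool" where
  "monochromatic_graph c F \<longleftrightarrow> (\<exists>i. \<forall>e \<in> edges F. c e = i)"

definition rainbow_graph :: "('a set \<Rightarrow> nat) \<Rightarrow> 'a graph \<Rightarrow> bool" where
  "rainbow_graph c F \<longleftrightarrow> inj_on c (edges F)"

text \<open>Natural numbers as colours suffice for ``any number of colours'', since complete graphs
  here are finite.\<close>

definition constrained_ramsey :: "'a graph \<Rightarrow> 'b graph \<Rightarrow> nat" where
  "constrained_ramsey H G =
     (LEAST n. \<forall>c :: nat set \<Rightarrow> nat.
        (\<exists>F. copy_in H F (complete_graph n) \<and> monochromatic_graph c F) \<or>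
        (\<exists>F. copy_in G F (complete_graph n) \<and> rainbow_graph c F))"

definition multicolor_ramsey :: "nat \<Rightarrow> 'a graph \<Rightarrow> nat" where
  "multicolor_ramsey r H =
     (LEAST n. \<forall>c :: nat set \<Rightarrow> nat. c ` edges (complete_graph n) \<subseteq> {1..r} \<longrightarrow>
        (\<exists>F. copy_in H F (complete_graph n) \<and> monochromatic_graph c F))"

end

theory Submission
  imports Defs
begin

text \<open>
  Three colours cannot produce a rainbow path with four edges, so only one inequality needs work:
  a colouring of \<open>K\<^sub>n\<close> without rainbow \<open>P\<^sub>5\<close>, where \<open>n\<close> has the three-colour Ramsey property for \<open>H\<close>,
  contains a monochromatic \<open>H\<close>. Let \<open>m\<close> be the number of non-isolated vertices of \<open>H\<close>. Explicit
  three-colourings show \<open>n \<ge> 9\<close> and \<open>n \<ge> 2m - 1\<close>. If at least four colours occur and some vertex sees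
  three of them, chasing short paths yields a monochromatic clique on \<open>n - 4 \<ge> m\<close> vertices.
  Otherwise any two vertex palettes meet and have at most two elements, so some colour \<open>D\<close> is
  dominant: the vertices split into parts with \<open>D\<close> between the parts and at most one further colour
  inside each part.

  In the dominant case let \<open>M\<close> be a largest part and merge the colours inside all parts other than
  \<open>M\<close> into one. The resulting three-colouring contains a monochromatic \<open>H\<close>, which may be assumed to
  use the merged colour and at least two parts. The 3-chromatic component \<open>C\<close> lies in one part \<open>J\<close>
  and some other component, having at least \<open>\<sigma>(H)\<close> vertices, in another part \<open>I\<close>. This is enough room to
  place the colour classes of \<open>C\<close> in \<open>M\<close>, \<open>J\<close>, \<open>I\<close> (the smallest in \<open>I\<close>) and the two classes of the
  bipartite rest on the two sides of a union of parts, which gives a copy of \<open>H\<close> in colour \<open>D\<close>.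
\<close>

subsection \<open>Colourings without a rainbow path on five vertices\<close>

lemma two_elements_if_card_ge_2:
  assumes "2 \<le> card A"
  obtains x y where "x \<in> A" "y \<in> A" "x \<noteq> y"
proof -
  obtain T where "T \<subseteq> A" "card T = 2" using assms by (meson obtain_subset_with_card_n)
  then show ?thesis using that by (auto simp: card_2_iff)
qed

locale rainbow_P5_free =
  fixes V :: "'a set" and f :: "'a \<Rightarrow> 'a \<Rightarrow> 'c"
  assumes finite_V: "finite V"
    and sym: "f u v = f v u"
    and no_rainbow: "\<lbrakk>a \<in> V; b \<in> V; c \<in> V; d \<in> V; e \<in> V; distinct [a, b, c, d, e]\<rbrakk>
      \<Longrightarrow> \<not> distinct [f a b, f b c, f c d, f d e]"
begin

text \<open>The diagonal is left out: \<open>f u u\<close> is the value of a loop and carries no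
  edge colour.\<close>

definition palette :: "'a \<Rightarrow> 'c set" where
  "palette u = f u ` (V - {u})"

definition mono_clique :: "'a set \<Rightarrow> bool" where
  "mono_clique K \<longleftrightarrow> K \<subseteq> V \<and> (\<exists>\<gamma>. \<forall>p\<in>K. \<forall>q\<in>K. p \<noteq> q \<longrightarrow> f p q = \<gamma>)"

lemma finite_palette: "finite (palette u)"
  using finite_V by (simp add: palette_def)

lemma palette_I: "\<lbrakk>w \<in> V; w \<noteq> u\<rbrakk> \<Longrightarrow> f u w \<in> palette u"
  by (simp add: palette_def)

lemma palettes_meet: "\<lbrakk>u \<in> V; w \<in> V; u \<noteq> w\<rbrakk> \<Longrightarrow> f u w \<in> palette u \<inter> palette w"
  using palette_I[of w u] palette_I[of u w] sym[of u w] by auto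

text \<open>The colour of the edge \<open>u w\<close> lies in both palettes, so palettes meet
  pairwise. Without a dominant colour three of them form a triangle \<open>{a, b}\<close>,
  \<open>{b, c}\<close>, \<open>{a, c}\<close>; every palette must meet all three sides and, having
  at most two elements, lies in \<open>{a, b, c}\<close>, against four colours.\<close>

lemma dominant_colour_if_palettes_le_2:
  assumes le2: "\<And>u. u \<in> V \<Longrightarrow> card (palette u) \<le> 2"
    and many: "card (\<Union>u\<in>V. palette u) \<ge> 4"
  shows "\<exists>D. \<forall>u\<in>V. \<forall>x\<in>palette u - {D}. \<forall>y\<in>palette u - {D}. x = y"
proof (rule ccontr)
  assume "\<not> ?thesis"
  then have nd: "\<exists>u\<in>V. \<exists>x\<in>palette u - {D}. \<exists>y\<in>palette u - {D}. x \<noteq> y" for D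
    by blast
  have pal2: "palette u = {x, y}" if "u \<in> V" "x \<in> palette u" "y \<in> palette u" "x \<noteq> y" for u x y
    using that le2[of u] card_seteq[OF finite_palette, of "{x, y}" u] by auto
  have meet: "palette u \<inter> palette w \<noteq> {}" if "u \<in> V" "w \<in> V" "palette u \<noteq> {}" for u w
    using palettes_meet[of u w] that by (cases "u = w") auto
  \<comment> \<open>Any value of \<open>D\<close> serves here: only a palette with two colours is
    wanted.\<close>
  obtain u0 a b where u0: "u0 \<in> V" "palette u0 = {a, b}" "a \<noteq> b"
    using nd[of undefined] pal2 by (metis DiffD1)
  obtain u1 c where u1: "u1 \<in> V" "palette u1 = {b, c}" "c \<noteq> a" "b \<noteq> c"
  proof -
    obtain u x y where u: "u \<in> V" "x \<in> palette u" "y \<in> palette u" "x \<noteq> y" "x \<noteq> a" "y \<noteq> a"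
      using nd[of a] by blast
    then have "palette u = {x, y}" using pal2 by blast
    then show ?thesis using meet[of u0 u] u0 u that[of u x] that[of u y] by auto
  qed
  obtain u2 where u2: "u2 \<in> V" "palette u2 = {a, c}"
  proof -
    obtain u x y where u: "u \<in> V" "x \<in> palette u" "y \<in> palette u" "x \<noteq> y" "x \<noteq> b" "y \<noteq> b"
      using nd[of b] by blast
    then have "palette u = {x, y}" using pal2 by blast
    then show ?thesis using meet[of u0 u] meet[of u1 u] u0 u1 u that[of u] by auto
  qed
  have "palette u \<subseteq> {a, b, c}" if u: "u \<in> V" for u
  proof -
    have "palette u \<inter> {a, b} \<noteq> {}" "palette u \<inter> {b, c} \<noteq> {}" "palette u \<inter> {a, c} \<noteq> {}"
      using meet[of u0 u] meet[of u1 u] meet[of u2 u] u u0 u1 u2 by auto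
    then obtain x y where "x \<in> palette u" "y \<in> palette u" "x \<noteq> y" "x \<in> {a, b, c}" "y \<in> {a, b, c}"
      using u0(3) u1(3,4) by blast
    then show ?thesis using pal2[OF u] by auto
  qed
  then have "(\<Union>u\<in>V. palette u) \<subseteq> {a, b, c}" by blast
  then have "card (\<Union>u\<in>V. palette u) \<le> card {a, b, c}" by (intro card_mono) auto
  also have "\<dots> \<le> 3" by (simp add: card_insert_if)
  finally show False using many by simp
qed

lemma card_colours_avoiding:
  assumes "inj_on (f v) X" "finite X" "finite S"
  shows "card {x \<in> X. f v x \<notin> S} + card S \<ge> card X"
proof -
  have "card {x \<in> X. f v x \<in> S} \<le> card S"
    by (rule card_inj_on_le[of "f v"]) (use assms in \<open>auto intro: inj_on_subset\<close>)
  moreover have "X = {x \<in> X. f v x \<notin> S} \<union> {x \<in> X. f v x \<in> S}" by blast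
  then have "card X \<le> card {x \<in> X. f v x \<notin> S} + card {x \<in> X. f v x \<in> S}"
    by (metis card_Un_le)
  ultimately show ?thesis by linarith
qed

section \<open>A vertex that sees at least four colours\<close>

context
  fixes v X
  assumes v: "v \<in> V" and X: "X \<subseteq> V - {v}" "inj_on (f v) X" "card X = 4"
begin

text \<open>Follow the path y-v-x-p-q for each of the other three leaves \<open>y\<close>: if
  \<open>f v x\<close>, \<open>f x p\<close>, \<open>f p q\<close> were distinct,
  \<open>f v y\<close> would be \<open>f x p\<close> or \<open>f p q\<close>, but three leaves have
  three colours.\<close>

lemma star_edge_to_outside:
  assumes "x \<in> X" "p \<in> V - insert v X" "q \<in> V - insert v X" "p \<noteq> q"
  shows "f x p = f p q \<or> f v x = f x p \<or> f v x = f p q"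
proof (rule ccontr)
  assume neg: "\<not> ?thesis"
  have finX: "finite X" using X(3) card.infinite by force
  have "f v y \<in> {f x p, f p q}" if y: "y \<in> X - {x}" for y
  proof -
    have "f v y \<noteq> f v x" using y X(2) assms(1) by (auto dest: inj_onD)
    moreover have "\<not> distinct [f y v, f v x, f x p, f p q]"
      by (rule no_rainbow) (use assms v X(1) y in auto)
    ultimately show ?thesis using neg sym[of y v] by auto
  qed
  then have "f v ` (X - {x}) \<subseteq> {f x p, f p q}" by blast
  then have "card (f v ` (X - {x})) \<le> card {f x p, f p q}" by (intro card_mono) auto
  moreover have "card (f v ` (X - {x})) = 3"
    using X assms(1) finX by (subst card_image) (auto intro: inj_on_subset)
  ultimately show False by (auto simp: card_insert_if split: if_splits)
qed

text \<open>Two of the four leaves avoid both \<open>f p q\<close> and \<open>f p r\<close>. Such a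
  leaf \<open>x\<close> repeats \<open>f v x\<close> towards \<open>p\<close>, as
  \<open>star_edge_to_outside\<close> holds for both \<open>q\<close> and \<open>r\<close>; then the
  edge between the two leaves has the \<open>v\<close>-colour of one of them, which
  \<open>main\<close> refutes.\<close>

lemma outside_star_monochromatic:
  assumes p: "p \<in> V - insert v X" and q: "q \<in> V - insert v X" and r: "r \<in> V - insert v X"
    and pqr: "p \<noteq> q" "p \<noteq> r"
  shows "f p q = f p r"
proof (rule ccontr)
  assume ne: "f p q \<noteq> f p r"
  then have qr: "q \<noteq> r" by auto
  have finX: "finite X" using X(3) card.infinite by force
  have "card {x \<in> X. f v x \<notin> {f p q, f p r}} \<ge> 2"
    using card_colours_avoiding[OF X(2) finX, of "{f p q, f p r}"] X(3) ne by auto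
  then obtain x y where xy: "x \<in> X" "y \<in> X" "x \<noteq> y" "f v x \<notin> {f p q, f p r}" "f v y \<notin> {f p q, f p r}"
    by (rule two_elements_if_card_ge_2) blast
  \<comment> \<open>By symmetry in \<open>x\<close> and \<open>y\<close> it is enough to treat
    \<open>f x y = f v x\<close>. The colours of \<open>x r\<close> and \<open>y r\<close> get fixed
    one after the other until x-y-r-p-q is rainbow.\<close>
  have main: False
    if x: "x \<in> X" "f v x \<notin> {f p q, f p r}" and y: "y \<in> X" "f v y \<notin> {f p q, f p r}"
      and xy: "x \<noteq> y" and e: "f x y = f v x" for x y
  proof -
    have mem: "p \<in> V" "q \<in> V" "r \<in> V" "x \<in> V" "y \<in> V" "distinct [v, p, q, r, x, y]"
      using p q r x(1) y(1) X(1) v pqr qr xy by auto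
    have ij: "f v x \<noteq> f v y" using x y xy X(2) by (auto dest: inj_onD)
    have yp: "f y p = f v y"
      using star_edge_to_outside[of y p q] star_edge_to_outside[of y p r] y p q r pqr ne by auto
    have xr: "f x r \<in> {f p r, f v x}" and yr: "f y r \<in> {f p r, f v y}"
      using star_edge_to_outside[of x r p] star_edge_to_outside[of y r p] x y p r pqr sym[of p r] by auto
    have xr': "f x r = f v x"
      using no_rainbow[of q p y x r] mem xr yp e ij ne x y sym[of q p] sym[of p y] sym[of y x] by auto
    have yr': "f y r = f v y"
      using no_rainbow[of q p y r x] mem xr' yr yp ij ne x y sym[of q p] sym[of p y] sym[of r x] by auto
    show False
      using no_rainbow[of x y r p q] mem e yr' ij ne x y sym[of r p] by auto
  qed
  have mem: "p \<in> V" "q \<in> V" "r \<in> V" "x \<in> V" "y \<in> V" "distinct [v, p, q, r, x, y]"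
    using p q r xy X(1) v pqr qr by auto
  have ij: "f v x \<noteq> f v y" using xy X(2) by (auto dest: inj_onD)
  have xp: "f x p = f v x"
    using star_edge_to_outside[of x p q] star_edge_to_outside[of x p r] xy p q r pqr ne by auto
  have "f x y \<in> {f p q, f v x, f v y}"
    using no_rainbow[of q p x y v] mem xp xy ij v sym[of q p] sym[of p x] sym[of y v] by auto
  moreover have "f x y \<in> {f p r, f v x, f v y}"
    using no_rainbow[of r p x y v] mem xp xy ij v sym[of r p] sym[of p x] sym[of y v] by auto
  ultimately have "f x y = f v x \<or> f x y = f v y" using ne by auto
  then show False using main[of x y] main[of y x] xy sym[of x y] by auto
qed

text \<open>Otherwise \<open>p\<close> sees \<open>x\<close>, \<open>y\<close>, \<open>z\<close> in
  the same colours as \<open>v\<close> does. Each side of the triangle then has the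
  \<open>v\<close>-colour of one of its ends (\<open>pair\<close>), and an end that owns one of its
  two sides owns both (\<open>step\<close>). The owner of the opposite side would thus own a side
  already taken.\<close>

lemma star_leaves_join_outside:
  assumes p: "p \<in> V - insert v X" and q: "q \<in> V - insert v X" and pq: "p \<noteq> q"
    and xyz: "x \<in> X" "y \<in> X" "z \<in> X" "distinct [x, y, z]"
    and avoid: "f v x \<noteq> f p q" "f v y \<noteq> f p q" "f v z \<noteq> f p q"
  shows "f x p = f p q"
proof (rule ccontr)
  assume neg: "f x p \<noteq> f p q"
  have mem: "p \<in> V" "q \<in> V" "x \<in> V" "y \<in> V" "z \<in> V" "distinct [v, p, q, x, y, z]"
    using p q xyz X(1) v pq by auto
  have ij: "distinct [f v x, f v y, f v z]" using xyz X(2) by (auto dest: inj_onD)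
  have xp: "f x p = f v x" using star_edge_to_outside[of x p q] xyz p q pq neg avoid by auto
  have yp: "f y p = f v y"
    using star_edge_to_outside[of y p q] no_rainbow[of z v y p x] mem v xyz p q pq avoid xp ij
      sym[of z v] sym[of p x] by auto
  have zp: "f z p = f v z"
    using star_edge_to_outside[of z p q] no_rainbow[of y v z p x] mem v xyz p q pq avoid xp ij
      sym[of y v] sym[of p x] by auto
  have pair: "f a b = f v a \<or> f a b = f v b"
    if "{a, b, c} = {x, y, z}" "distinct [a, b, c]" for a b c
  proof -
    have abc: "a \<in> {x, y, z}" "b \<in> {x, y, z}" "c \<in> {x, y, z}" using that(1) by auto
    have abp: "f a p = f v a" "f b p = f v b" "f v a \<noteq> f p q" "f v b \<noteq> f p q"
      using abc xp yp zp avoid by auto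
    have abm: "a \<in> V" "b \<in> V" "c \<in> V" "distinct [v, p, q, a, b, c]" 
      using abc mem that by auto
    have abd: "distinct [f v a, f v b, f v c]" using abc that(2) ij by auto
    have "f a b \<in> {f p q, f v a, f v b}"
      using no_rainbow[of q p a b v] mem v abp abm abd sym[of q p] sym[of p a] sym[of b v] by auto
    moreover have "f a b \<in> {f v c, f v a, f v b}" if "f a b = f p q"
      using no_rainbow[of c v a b p] mem v abp abm abd sym[of c v] that by auto
    moreover have "f v c \<noteq> f p q" using abc avoid by auto
    ultimately show ?thesis by auto
  qed
  have step: "f a c = f v a" if "{a, b, c} = {x, y, z}" "distinct [a, b, c]" "f a b = f v a" for a b c
  proof -
    have abc: "a \<in> {x, y, z}" "b \<in> {x, y, z}" "c \<in> {x, y, z}" using that(1) by auto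
    have "f b p = f v b" "f v a \<noteq> f p q" "f v b \<noteq> f p q" "f v c \<noteq> f p q" using abc xp yp zp avoid by auto
    moreover have "a \<in> V" "b \<in> V" "c \<in> V" "distinct [v, p, q, a, b, c]" 
      using abc mem that by auto
    moreover have "distinct [f v a, f v b, f v c]" using abc that(2) ij by auto
    moreover have "f a c = f v a \<or> f a c = f v c"
      by (rule pair[of a c b]) (use that in auto)
    ultimately show ?thesis
      using no_rainbow[of q p b a c] mem that(3) sym[of q p] sym[of p b] sym[of b a] by auto
  qed
  have d: "x \<noteq> y" "y \<noteq> z" "x \<noteq> z" using xyz(4) by auto
  have "f x y = f v x \<or> f x y = f v y" using pair[of x y z] d by simp
  moreover have "f y z = f v y \<or> f y z = f v z" using pair[of y z x] d by (simp add: insert_commute sym)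
  moreover have "f x z = f v x \<or> f x z = f v z" using pair[of x z y] d by (simp add: insert_commute sym)
  moreover have "f x z = f v x \<longrightarrow> f x y = f v x" using step[of x z y] d by (simp add: insert_commute sym)
  moreover have "f x z = f v z \<longrightarrow> f y z = f v z" using step[of z x y] d by (simp add: insert_commute sym)
  moreover have "f x y = f v x \<longrightarrow> f x z = f v x" using step[of x y z] d by simp
  moreover have "f x y = f v y \<longrightarrow> f y z = f v y" using step[of y x z] d by (simp add: insert_commute sym)
  moreover have "f y z = f v y \<longrightarrow> f x y = f v y" using step[of y z x] d by (simp add: insert_commute sym)
  moreover have "f y z = f v z \<longrightarrow> f x z = f v z" using step[of z y x] d by (simp add: insert_commute sym)
  moreover have "f v x \<noteq> f v y" "f v y \<noteq> f v z" "f v x \<noteq> f v z" using ij by auto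
  ultimately show False by metis
qed

end

text \<open>Outside \<open>v\<close> and four leaves there are \<open>card V - 5\<close> vertices, a
  clique in one colour \<gamma>. At most one leaf has colour \<gamma> at \<open>v\<close>, so three
  avoid it, and by \<open>star_leaves_join_outside\<close> one of them can be added to the clique.
  With \<open>card V \<ge> 7\<close> there are two outside vertices to define \<gamma>.\<close>

lemma mono_clique_if_palette_ge_4:
  assumes v: "v \<in> V" and pal: "card (palette v) \<ge> 4" and n: "card V \<ge> 7"
  shows "\<exists>K. mono_clique K \<and> card K + 4 \<ge> card V"
proof -
  obtain S where S: "S \<subseteq> palette v" "card S = 4" by (meson obtain_subset_with_card_n pal)
  obtain X where X: "X \<subseteq> V - {v}" "inj_on (f v) X" "f v ` X = S"
    using S(1) unfolding palette_def subset_image_inj by blast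
  then have cX: "card X = 4" using S(2) card_image[OF X(2)] by simp
  then have finX: "finite X" using card.infinite by force
  let ?P = "V - insert v X"
  have cP: "card ?P + 5 = card V"
  proof -
    have "card (insert v X) = 5" using X(1) cX finX by (subst card_insert_disjoint) auto
    moreover have "insert v X \<subseteq> V" using v X(1) by auto
    ultimately show ?thesis
      using card_Diff_subset[of "insert v X" V] finX n card_mono[OF finite_V, of "insert v X"] by simp
  qed
  then have "2 \<le> card ?P" using n by simp
  then obtain p0 q0 where pq0: "p0 \<in> ?P" "q0 \<in> ?P" "p0 \<noteq> q0"
    by (rule two_elements_if_card_ge_2)
  define \<gamma> where "\<gamma> = f p0 q0"
  note out = outside_star_monochromatic[OF v X(1,2) cX]
  have mono: "f p q = \<gamma>" if "p \<in> ?P" "q \<in> ?P" "p \<noteq> q" for p q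
  proof (cases "p = p0")
    case True
    then show ?thesis using out[of p0 q q0] that pq0 \<gamma>_def by auto
  next
    case False
    have "f p q = f p p0" using out[of p q p0] that pq0 False by auto
    also have "\<dots> = f p0 p" by (rule sym)
    also have "\<dots> = f p0 q0" using out[of p0 p q0] that pq0 False by auto
    finally show ?thesis by (simp add: \<gamma>_def)
  qed
  have "card {x \<in> X. f v x \<notin> {\<gamma>}} \<ge> 3"
    using card_colours_avoiding[OF X(2) finX, of "{\<gamma>}"] cX by simp
  then obtain T where T: "T \<subseteq> {x \<in> X. f v x \<notin> {\<gamma>}}" "card T = 3"
    by (meson obtain_subset_with_card_n)
  then obtain x y z where xyz: "T = {x, y, z}" "x \<noteq> y" "y \<noteq> z" "x \<noteq> z"
    by (auto simp: card_3_iff)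
  have join: "f x p = \<gamma>" if p: "p \<in> ?P" for p
  proof -
    obtain q where q: "q \<in> ?P" "p \<noteq> q" using pq0 by metis
    have "f x p = f p q"
      by (rule star_leaves_join_outside[OF v X(1,2) cX p q, of x y z])
        (use T xyz mono[OF p q] in auto)
    then show ?thesis using mono[OF p q] by simp
  qed
  have "mono_clique (insert x ?P)"
    unfolding mono_clique_def
  proof (intro conjI exI[of _ \<gamma>] ballI impI)
    show "insert x ?P \<subseteq> V" using T xyz X(1) by auto
    show "f p q = \<gamma>" if "p \<in> insert x ?P" "q \<in> insert x ?P" "p \<noteq> q" for p q
      using that mono[of p q] join[of p] join[of q] sym[of p x] by auto
  qed
  moreover have "card (insert x ?P) = Suc (card ?P)"
    using T xyz finite_V by (subst card_insert_disjoint) auto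
  ultimately show ?thesis using cP by (intro exI[of _ "insert x ?P"]) auto
qed


section \<open>An edge whose colour is missing at a vertex that sees exactly three colours\<close>

lemma fourth_colour_spreads:
  assumes mem: "v \<in> V" "z \<in> V" "w \<in> V" "x \<in> V" "y \<in> V" "u \<in> V"
    and dist: "distinct [v, z, w, x, y, u]"
    and cols: "f v z = c1" "f v w = c1" "f v x = c2" "f v y = c3" "f v u \<in> {c1, c2, c3}"
    and zw: "f z w = \<phi>" and dc: "distinct [c1, c2, c3, \<phi>]"
  shows "f z y = \<phi>"
proof (rule ccontr)
  assume neg: "f z y \<noteq> \<phi>"
  \<comment> \<open>Two paths leave only \<phi> and \<open>c2\<close> for \<open>z y\<close>.
    Against \<open>c2\<close> the sixth vertex \<open>u\<close> is used: each of its three possible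
    colours at \<open>v\<close> leads to a rainbow path.\<close>
  have "f z y \<in> {c1, c2, \<phi>}"
    using no_rainbow[of x v w z y] mem dist cols zw dc sym[of x v] sym[of w z] by auto
  moreover have "f z y \<in> {c2, c3, \<phi>}"
    using no_rainbow[of x v y z w] mem dist cols zw dc sym[of x v] sym[of y z] by auto
  ultimately have zy: "f z y = c2" using neg dc by auto
  consider "f v u = c1" | "f v u = c2" | "f v u = c3" using cols by auto
  then show False
  proof cases
    case 1
    then show False
      using no_rainbow[of u v y z w] mem dist cols zw dc zy sym[of u v] sym[of y z] by auto
  next
    case 2
    have "f z x \<in> {c1, c2, \<phi>}"
      using no_rainbow[of u v w z x] mem dist cols zw dc 2 sym[of u v] sym[of w z] by auto
    moreover have "f z x \<in> {c1, c3, \<phi>}"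
      using no_rainbow[of y v w z x] mem dist cols zw dc sym[of y v] sym[of w z] by auto
    moreover have "f z x \<in> {c2, c3, \<phi>}"
      using no_rainbow[of y v x z w] mem dist cols zw dc sym[of y v] sym[of x z] by auto
    ultimately have "f z x = \<phi>" using dc by auto
    then show False
      using no_rainbow[of x z y v w] mem dist cols dc zy sym[of x z] sym[of y v] by auto
  next
    case 3
    then show False
      using no_rainbow[of u v w z y] mem dist cols zw dc zy sym[of u v] sym[of w z] by auto
  qed
qed

text \<open>Vertices with colour \<open>c2\<close> or \<open>c3\<close> at \<open>v\<close> are
  settled by \<open>fourth_colour_spreads\<close>, whose sixth vertex exists by
  \<open>card V \<ge> 6\<close>. For the others, \<open>z x\<close> with \<open>x\<close> of colour
  \<open>c2\<close> is then known to have colour \<phi>, and this excludes \<open>c1\<close> through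
  u-z-x-v-y.\<close>

lemma fourth_colour_star:
  assumes mem: "v \<in> V" "z \<in> V" "w \<in> V" and pal: "palette v = {c1, c2, c3}" and n: "card V \<ge> 6"
    and vzw: "v \<noteq> z" "v \<noteq> w" "z \<noteq> w"
    and cols: "f v z = c1" "f v w = c1"
    and zw: "f z w = \<phi>" and dc: "distinct [c1, c2, c3, \<phi>]"
    and u: "u \<in> V" "u \<noteq> v" "u \<noteq> z"
  shows "f z u = \<phi>"
proof -
  \<comment> \<open>\<open>d1\<close>, \<open>d2\<close> are \<open>c2\<close>, \<open>c3\<close> in
    either order, so that one argument serves both colours.\<close>
  have toc2: "f z y = \<phi>" if y: "y \<in> V" "y \<noteq> v" "f v y = d2" and d: "distinct [c1, d1, d2, \<phi>]" "d1 = c2 \<and> d2 = c3 \<or> d1 = c3 \<and> d2 = c2" for d1 d2 y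
  proof -
    have "d1 \<in> palette v" using d pal by auto
    then obtain x where x: "x \<in> V" "x \<noteq> v" "f v x = d1" by (auto simp: palette_def)
    have dist: "distinct [v, z, w, x, y]" using x y d vzw cols by auto
    have "card (set [v, z, w, x, y]) < card V" using distinct_card[OF dist] n by simp
    then have "\<not> V \<subseteq> set [v, z, w, x, y]" by (meson List.finite_set card_mono leD)
    then obtain t where t: "t \<in> V" "t \<notin> set [v, z, w, x, y]" by blast
    have "f v t \<in> palette v" using t by (intro palette_I) auto
    then have "f v t \<in> {c1, d1, d2}" using pal d by auto
    then show ?thesis
      using fourth_colour_spreads[of v z w x y t c1 d1 d2 \<phi>] mem x y t dist cols zw d by auto
  qed
  have "f v u \<in> {c1, c2, c3}" using palette_I[of u v] u pal by auto
  then consider "f v u = c2" | "f v u = c3" | "u = w" | "f v u = c1" "u \<noteq> w" by auto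
  then show ?thesis
  proof cases
    case 1 then show ?thesis using toc2[of u c2 c3] u dc by auto
  next
    case 2 then show ?thesis using toc2[of u c3 c2] u dc by auto
  next
    case 3 then show ?thesis using zw by simp
  next
    case 4
    have "c2 \<in> palette v" "c3 \<in> palette v" using pal by auto
    then obtain x y where x: "x \<in> V" "x \<noteq> v" "f v x = c2" and y: "y \<in> V" "y \<noteq> v" "f v y = c3"
      by (auto simp: palette_def)
    have zx: "f z x = \<phi>" using toc2[of x c2 c3] x dc by auto
    have dist: "distinct [v, z, w, x, y, u]" using x y u vzw cols dc 4 by auto
    have "f z u \<in> {c1, c2, \<phi>}"
      using no_rainbow[of x v w z u] mem x u dist cols dc zw sym[of x v] sym[of w z] by auto
    moreover have "f z u \<in> {c1, c3, \<phi>}"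
      using no_rainbow[of y v w z u] mem y u dist cols dc zw sym[of y v] sym[of w z] by auto
    moreover have "f z u \<noteq> c1"
      using no_rainbow[of u z x v y] mem x y u dist zx dc sym[of u z] sym[of x v] by auto
    ultimately show ?thesis using dc by auto
  qed
qed

text \<open>By \<open>fourth_colour_star\<close> the vertex \<open>z\<close>, and then each vertex
  with colour \<open>c1\<close> at \<open>v\<close>, is joined in \<phi> to everything except
  \<open>v\<close>. The remaining edges \<open>p q\<close> are forced to \<phi> by paths through
  \<open>z\<close> and a vertex \<open>y\<close> whose colour at \<open>v\<close> is the one of
  \<open>c2\<close>, \<open>c3\<close> that \<open>p\<close> lacks (\<open>other\<close>).\<close>

lemma mono_clique_if_fourth_colour_in_neighbourhood:
  assumes mem: "v \<in> V" "z \<in> V" "w \<in> V" and pal: "palette v = {c1, c2, c3}" and n: "card V \<ge> 6"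
    and vzw: "v \<noteq> z" "v \<noteq> w" "z \<noteq> w"
    and cols: "f v z = c1" "f v w = c1"
    and zw: "f z w = \<phi>" and dc: "distinct [c1, c2, c3, \<phi>]"
  shows "\<exists>K. mono_clique K \<and> card K + 4 \<ge> card V"
proof -
  note star = fourth_colour_star[OF _ _ _ pal n _ _ _ _ _ _ dc]
  have zu: "f z u = \<phi>" if "u \<in> V" "u \<noteq> v" "u \<noteq> z" for u
    using star[of z w u] mem vzw cols zw that by auto
  have c1: "f p u = \<phi>" if "u \<in> V" "u \<noteq> v" "u \<noteq> p" "p \<in> V" "p \<noteq> v" "f v p = c1" for u p
    using star[of p z u] mem vzw cols zw that zu[of p] zu[of u] sym[of p z] by (cases "p = z") auto
  have other: "f p q = \<phi>"
    if p: "p \<in> V" "p \<noteq> v" "f v p = d1" and q: "q \<in> V" "q \<noteq> v" "q \<noteq> p"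
      and y: "y \<in> V" "y \<noteq> v" "f v y = d2" "y \<noteq> q"
      and d: "distinct [c1, d1, d2, \<phi>]" for p q y d1 d2
  proof (cases "f v q = c1")
    case True
    then show ?thesis using c1[of p q] p q sym[of p q] by auto
  next
    case False
    have dist: "distinct [v, z, w, p, q, y]" using p q y vzw cols d False by auto
    have zp: "f z p = \<phi>" "f z q = \<phi>" using zu p q dist by auto
    have "f p q \<in> {d2, d1, \<phi>}"
      using no_rainbow[of y v p q z] mem p q y dist zp d sym[of y v] sym[of q z] by auto
    moreover have "f p q \<in> {\<phi>, c1, d2}"
      using no_rainbow[of q p z v y] mem p q y dist zp d cols sym[of q p] sym[of p z] sym[of z v] by auto
    moreover have "f p q \<in> {c1, d1, \<phi>}"
      using no_rainbow[of w v p q z] mem p q y dist zp d cols sym[of w v] sym[of q z] by auto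
    ultimately show ?thesis using d by auto
  qed
  have "c2 \<in> palette v" "c3 \<in> palette v" using pal by auto
  then obtain x y where x: "x \<in> V" "x \<noteq> v" "f v x = c2" and y: "y \<in> V" "y \<noteq> v" "f v y = c3"
    by (auto simp: palette_def)
  \<comment> \<open>\<open>x\<close> is left out of the clique so that it differs from both ends and
    can witness \<open>c2\<close> when an end has colour \<open>c3\<close>. If neither end has,
    \<open>y\<close> differs from both and witnesses \<open>c3\<close>.\<close>
  have "f p q = \<phi>" if pq: "p \<in> V - {v, x}" "q \<in> V - {v, x}" "p \<noteq> q" for p q
  proof -
    have c: "f v p \<in> {c1, c2, c3}" "f v q \<in> {c1, c2, c3}"
      using palette_I[of p v] palette_I[of q v] pq pal by auto
    show ?thesis
    proof (cases "f v p = c3")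
      case True
      then show ?thesis using other[of p c3 q x c2] pq x dc by auto
    next
      case p3: False
      show ?thesis
      proof (cases "f v q = c3")
        case True
        then show ?thesis using other[of q c3 p x c2] pq x dc sym[of p q] by auto
      next
        case False
        then show ?thesis using other[of p c2 q y c3] c1[of q p] pq y dc c p3 by auto
      qed
    qed
  qed
  then have "mono_clique (V - {v, x})" by (auto simp: mono_clique_def)
  moreover have "card (V - {v, x}) + 4 \<ge> card V"
    using diff_card_le_card_Diff[of "{v, x}" V] x by simp
  ultimately show ?thesis by blast
qed

text \<open>\<open>excl\<close> shows that \<open>z\<close> and \<open>w\<close> are the only
  vertices with colours \<open>c1\<close> and \<open>c2\<close> at \<open>v\<close>. All others have
  colour \<open>c3\<close> there, and paths through \<open>v\<close>, \<open>z\<close>,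
  \<open>w\<close> together with \<open>no_inner\<close> force \<open>c3\<close> between them
  too.\<close>

lemma mono_clique_if_fourth_colour_across:
  assumes mem: "v \<in> V" "z \<in> V" "w \<in> V" and pal: "palette v = {c1, c2, c3}" and n: "card V \<ge> 6"
    and vzw: "v \<noteq> z" "v \<noteq> w" "z \<noteq> w"
    and cols: "f v z = c1" "f v w = c2"
    and zw: "f z w = \<phi>" and dc: "distinct [c1, c2, c3, \<phi>]"
    and le3: "\<And>u. u \<in> V \<Longrightarrow> card (palette u) \<le> 3"
    and no_inner: "\<And>p q. \<lbrakk>p \<in> V - {v}; q \<in> V - {v}; p \<noteq> q; f v p = f v q\<rbrakk> \<Longrightarrow> f p q \<noteq> \<phi>"
  shows "\<exists>K. mono_clique K \<and> card K + 4 \<ge> card V"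
proof -
  have "c3 \<in> palette v" using pal by auto
  then obtain x where x: "x \<in> V" "x \<noteq> v" "f v x = c3" by (auto simp: palette_def)
  \<comment> \<open>\<open>z\<close> and \<open>w\<close> are rebound so that the claim also applies
    with the two exchanged. The bound \<open>le3\<close> enters here: colour \<open>d2\<close> on
    \<open>z u\<close> would be a fourth one at \<open>z\<close>.\<close>
  have excl: False
    if m: "z \<in> V" "w \<in> V" "v \<noteq> z" "v \<noteq> w" "z \<noteq> w" and c: "f v z = d1" "f v w = d2"
      and zw: "f z w = \<phi>" and d: "distinct [d1, d2, c3, \<phi>]"
      and y: "y \<in> V" "y \<notin> {v, z, w}" "f v y = d1" for z w y d1 d2
  proof -
    have dist: "distinct [v, z, w, x, y]" using m c d x y by auto
    have "card (set [v, z, w, x, y]) < card V" using distinct_card[OF dist] n by simp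
    then have "\<not> V \<subseteq> set [v, z, w, x, y]" by (meson List.finite_set card_mono leD)
    then obtain u where u: "u \<in> V" "u \<notin> set [v, z, w, x, y]" by blast
    have "f z y \<in> {d1, c3, \<phi>}"
      using no_rainbow[of x v y z w] mem m x y dist c zw d sym[of x v] sym[of y z] by auto
    moreover have "f z y \<in> {d2, c3, \<phi>}"
      using no_rainbow[of x v w z y] mem m x y dist c zw d sym[of x v] sym[of w z] by auto
    moreover have "f z y \<noteq> \<phi>" using no_inner[of z y] m y c by auto
    ultimately have zy: "f z y = c3" using d by auto
    have "f z u \<in> {d1, d2, \<phi>}"
      using no_rainbow[of y v w z u] mem m u y dist c zw d sym[of y v] sym[of w z] by auto
    moreover have "f z u \<in> {c3, d2, \<phi>}"
      using no_rainbow[of x v w z u] mem m u x dist c zw d sym[of x v] sym[of w z] by auto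
    moreover have "f z u \<noteq> d2"
    proof
      assume "f z u = d2"
      then have "{d1, \<phi>, c3, d2} \<subseteq> palette z"
        using palette_I[of v z] palette_I[of w z] palette_I[of y z] palette_I[of u z] mem m y u dist zy zw c sym[of z v] by auto
      then have "card {d1, \<phi>, c3, d2} \<le> card (palette z)" by (intro card_mono finite_palette)
      then show False using le3[OF m(1)] d by auto
    qed
    ultimately have "f z u = \<phi>" using d by auto
    then show False
      using no_rainbow[of u z y v w] mem m u y dist c zy d sym[of u z] sym[of y v] by auto
  qed
  have c3: "f v u = c3" if u: "u \<in> V - {v, z, w}" for u
  proof -
    have "f v u \<in> {c1, c2, c3}" using palette_I[of u v] u pal by auto
    moreover have "f v u \<noteq> c1" using excl[of z w c1 c2 u] mem vzw cols zw dc u by auto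
    moreover have "f v u \<noteq> c2" using excl[of w z c2 c1 u] mem vzw cols zw dc u sym[of w z] by auto
    ultimately show ?thesis by auto
  qed
  have "f p q = c3" if pq: "p \<in> V - {v, z, w}" "q \<in> V - {v, z, w}" "p \<noteq> q" for p q
  proof -
    have vp: "f v p = c3" "f v q = c3" using c3 pq by auto
    have "f p q \<in> {c3, c1, \<phi>}"
      using no_rainbow[of p q v z w] mem pq vp vzw cols zw dc sym[of q v] by auto
    moreover have "f p q \<in> {c3, c2, \<phi>}"
      using no_rainbow[of p q v w z] mem pq vp vzw cols zw dc sym[of q v] sym[of w z] by auto
    moreover have "f p q \<noteq> \<phi>" using no_inner[of p q] pq vp by auto
    ultimately show ?thesis using dc by auto
  qed
  then have "mono_clique (V - {v, z, w})" by (auto simp: mono_clique_def)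
  moreover have "card (V - {v, z, w}) + 4 \<ge> card V"
    using diff_card_le_card_Diff[of "{v, z, w}" V] vzw by simp
  ultimately show ?thesis by blast
qed

text \<open>A vertex \<open>v\<close> with exactly three colours misses the colour of some edge
  \<open>z w\<close>, as four occur. The split is on whether this colour also joins two vertices of
  equal colour at \<open>v\<close>; if not, \<open>z\<close> and \<open>w\<close> themselves have
  different colours there.\<close>

lemma dominant_colour_or_large_mono_clique:
  assumes n: "card V \<ge> 7" and many: "card (\<Union>u\<in>V. palette u) \<ge> 4"
  shows "(\<exists>D. \<forall>u\<in>V. \<forall>x\<in>palette u - {D}. \<forall>y\<in>palette u - {D}. x = y) \<or>
    (\<exists>K. mono_clique K \<and> card K + 4 \<ge> card V)"
proof -
  have trich: "card (palette u) \<le> 2 \<or> card (palette u) = 3 \<or> card (palette u) \<ge> 4" for u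
    by linarith
  consider "\<forall>u\<in>V. card (palette u) \<le> 2" | v where "v \<in> V" "card (palette v) \<ge> 4"
    | v where "v \<in> V" "card (palette v) = 3" "\<forall>u\<in>V. \<not> card (palette u) \<ge> 4"
    using trich by blast
  then show ?thesis
  proof cases
    case 1
    then show ?thesis using dominant_colour_if_palettes_le_2[OF _ many] by blast
  next
    case 2
    then show ?thesis using mono_clique_if_palette_ge_4[OF _ _ n] by blast
  next
    case (3 v)
    have le3: "card (palette u) \<le> 3" if "u \<in> V" for u using 3(3) that by force
    have n6: "card V \<ge> 6" using n by simp
    have "\<not> (\<Union>u\<in>V. palette u) \<subseteq> palette v"
    proof
      assume "(\<Union>u\<in>V. palette u) \<subseteq> palette v"
      from card_mono[OF finite_palette this] show False using many 3 by simp
    qed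
    then obtain z w where zw: "z \<in> V" "w \<in> V" "z \<noteq> w" "f z w \<notin> palette v"
      by (auto simp: palette_def)
    have vz: "v \<noteq> z" "v \<noteq> w"
      using zw palette_I[of w z] palette_I[of z w] sym[of z w] by auto
    have cols: "f v z \<in> palette v" "f v w \<in> palette v" using vz zw by (auto intro: palette_I)
    show ?thesis
    proof (cases "\<exists>p q. p \<in> V - {v} \<and> q \<in> V - {v} \<and> p \<noteq> q \<and> f v p = f v q \<and> f p q = f z w")
      case True
      then obtain p q where pq: "p \<in> V" "q \<in> V" "p \<noteq> v" "q \<noteq> v" "p \<noteq> q" "f v p = f v q" "f p q = f z w"
        by auto
      have "f v p \<in> palette v" using pq by (auto intro: palette_I)
      then have "card (palette v - {f v p}) = 2" using 3 finite_palette by simp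
      then obtain c2 c3 where c: "palette v - {f v p} = {c2, c3}" "c2 \<noteq> c3" by (auto simp: card_2_iff)
      then have pal: "palette v = {f v p, c2, c3}" using \<open>f v p \<in> palette v\<close> by blast
      have "f v p \<notin> {c2, c3}" unfolding c(1)[symmetric] by simp
      moreover have "f z w \<notin> {f v p, c2, c3}" unfolding pal[symmetric] using zw(4) .
      ultimately have d: "distinct [f v p, c2, c3, f z w]" using c(2) by auto
      show ?thesis
        using mono_clique_if_fourth_colour_in_neighbourhood
          [OF 3(1) pq(1,2) pal n6 pq(3,4)[symmetric] pq(5) refl pq(6)[symmetric] pq(7) d] by blast
    next
      case False
      have ne: "f v z \<noteq> f v w" using False zw vz by auto
      then have "card (palette v - {f v z, f v w}) = 1" using 3 cols finite_palette by (simp add: card_Diff_subset)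
      then obtain c3 where c: "palette v - {f v z, f v w} = {c3}" by (auto simp: card_1_singleton_iff)
      then have pal: "palette v = {f v z, f v w, c3}" using cols by blast
      have "c3 \<notin> {f v z, f v w}" using c by blast
      moreover have "f z w \<notin> {f v z, f v w, c3}" unfolding pal[symmetric] using zw(4) .
      ultimately have "distinct [f v z, f v w, c3, f z w]" using ne by auto
      then show ?thesis
        using mono_clique_if_fourth_colour_across[OF 3(1) zw(1,2) pal n6 vz zw(3) refl refl refl] le3 False
        by blast
    qed
  qed
qed

end

subsection \<open>Embedding into complete multipartite graphs\<close>

lemma inj_on_extend:
  assumes "finite S" "finite T" "A \<subseteq> S" "inj_on g A" "g ` A \<subseteq> T" "card S \<le> card T"
  obtains h where "inj_on h S" "h ` S \<subseteq> T" "\<forall>a\<in>A. h a = g a"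
proof -
  have finA: "finite A" using assms finite_subset by blast
  have "card (S - A) \<le> card (T - g ` A)"
    using assms finA by (simp add: card_Diff_subset card_image)
  then obtain k where k: "k ` (S - A) \<subseteq> T - g ` A" "inj_on k (S - A)"
    using card_le_inj[of "S - A" "T - g ` A"] assms by auto
  let ?h = "\<lambda>x. if x \<in> A then g x else k x"
  have "inj_on ?h (A \<union> (S - A))"
    by (rule inj_on_disjoint_Un[OF assms(4) k(2)]) (use k(1) in blast)
  then have "inj_on ?h S" using assms(3) by (simp add: Un_absorb1)
  moreover have "?h ` S \<subseteq> T" using k assms(5) by auto
  ultimately show ?thesis using that[of ?h] by simp
qed

text \<open>If part \<open>M\<close> alone has \<open>m / 2\<close> vertices, \<open>L = {M}\<close>
  works. Otherwise every part has fewer, and a smallest admissible \<open>L\<close> stays below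
  \<open>m\<close> because removing one label takes it below \<open>m / 2\<close>; at least
  \<open>m\<close> of the \<open>2 * m - 1\<close> or more vertices remain outside.\<close>

lemma split_multipartite:
  fixes \<l> :: "'v \<Rightarrow> 'l"
  assumes V: "finite V" "card V + 1 \<ge> 2 * m" "card (V - {x \<in> V. \<l> x = M}) \<ge> m"
    and M: "\<And>l. card {x \<in> V. \<l> x = l} \<le> card {x \<in> V. \<l> x = M}"
    and MIJ: "M \<noteq> I" "M \<noteq> J"
  obtains L where "M \<in> L" "I \<notin> L" "J \<notin> L"
    "2 * card {x \<in> V. \<l> x \<in> L} \<ge> m" "card {x \<in> V. \<l> x \<notin> L} \<ge> m"
proof (cases "2 * card {x \<in> V. \<l> x = M} \<ge> m")
  case True
  have "V - {x \<in> V. \<l> x = M} = {x \<in> V. \<l> x \<notin> {M}}" by auto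
  then show ?thesis using that[of "{M}"] True V(3) MIJ by auto
next
  case False
  have small: "2 * card {x \<in> V. \<l> x = l} < m" for l using M[of l] False by linarith
  let ?X = "\<lambda>L. {x \<in> V. \<l> x \<in> L}"
  let ?P = "\<lambda>L. finite L \<and> M \<in> L \<and> I \<notin> L \<and> J \<notin> L \<and> 2 * card (?X L) \<ge> m"
  \<comment> \<open>All labels except \<open>I\<close> and \<open>J\<close> are admissible, since
    these two parts together hold fewer than \<open>m\<close> vertices.\<close>
  have "?P (insert M (\<l> ` V - {I, J}))"
  proof -
    let ?L = "insert M (\<l> ` V - {I, J})"
    have "V = ?X ?L \<union> {x \<in> V. \<l> x = I} \<union> {x \<in> V. \<l> x = J}" by auto
    then have "card V \<le> card (?X ?L) + card {x \<in> V. \<l> x = I} + card {x \<in> V. \<l> x = J}"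
      by (metis (no_types, lifting) add_le_mono1 card_Un_le le_trans)
    then have "2 * card (?X ?L) \<ge> m" using small[of I] small[of J] V(2) by linarith
    then show ?thesis using V(1) MIJ by auto
  qed
  from ex_has_least_nat[of ?P, OF this, of card] obtain L
    where L: "?P L" and least: "\<And>L'. ?P L' \<Longrightarrow> card L \<le> card L'" by blast
  have "L \<noteq> {M}" using L False by auto
  then obtain l where l: "l \<in> L" "l \<noteq> M" using L by auto
  have "\<not> ?P (L - {l})" using least[of "L - {l}"] card_Diff1_less[of L l] l L by auto
  then have "2 * card (?X (L - {l})) < m" using L l by auto
  moreover have "?X L = ?X (L - {l}) \<union> {x \<in> V. \<l> x = l}" using l by auto
  then have "card (?X L) \<le> card (?X (L - {l})) + card {x \<in> V. \<l> x = l}"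
    by (metis (no_types, lifting) card_Un_le)
  ultimately have "card (?X L) < m" using small[of l] by linarith
  moreover have "{x \<in> V. \<l> x \<notin> L} = V - ?X L" by auto
  then have "card {x \<in> V. \<l> x \<notin> L} = card V - card (?X L)"
    using V(1) by (simp add: card_Diff_subset)
  ultimately have "card {x \<in> V. \<l> x \<notin> L} \<ge> m" using V(2) by linarith
  then show ?thesis using that[of L] L by auto
qed

text \<open>\<open>A\<close>, \<open>B\<close>, \<open>Z\<close> stand for the colour classes of the
  3-chromatic component, \<open>P\<close>, \<open>Q\<close> for those of the rest. Taking the
  smaller of \<open>A\<close>, \<open>B\<close> and of \<open>P\<close>, \<open>Q\<close> keeps
  \<open>A \<union> P\<close> within half of all vertices, so it fits into \<open>L\<close>;
  everything else goes outside \<open>L\<close>, where there is room for all.\<close>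

lemma embed_into_multipartite:
  fixes \<l> :: "'v \<Rightarrow> 'l"
  assumes V: "finite V" "card V + 1 \<ge> 2 * card (C \<union> P \<union> Q)"
      "card (V - {x \<in> V. \<l> x = M}) \<ge> card (C \<union> P \<union> Q)"
    and M: "\<And>l. card {x \<in> V. \<l> x = l} \<le> card {x \<in> V. \<l> x = M}"
    and MIJ: "M \<noteq> I" "M \<noteq> J" "I \<noteq> J"
    and fin: "finite (C \<union> P \<union> Q)"
    and C: "C = A \<union> B \<union> Z" "A \<inter> B = {}" "A \<inter> Z = {}" "B \<inter> Z = {}"
    and disj: "C \<inter> P = {}" "C \<inter> Q = {}" "P \<inter> Q = {}"
    and AB: "card A \<le> card B" and PQ: "card P \<le> card Q"
    and J: "card C \<le> card {x \<in> V. \<l> x = J}" and I: "card Z \<le> card {x \<in> V. \<l> x = I}"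
  obtains \<phi> where "inj_on \<phi> (C \<union> P \<union> Q)" "\<phi> ` (C \<union> P \<union> Q) \<subseteq> V"
    "\<And>u. u \<in> A \<Longrightarrow> \<l> (\<phi> u) = M" "\<And>u. u \<in> B \<Longrightarrow> \<l> (\<phi> u) = J" "\<And>u. u \<in> Z \<Longrightarrow> \<l> (\<phi> u) = I"
    "\<And>u w. \<lbrakk>u \<in> P; w \<in> Q\<rbrakk> \<Longrightarrow> \<l> (\<phi> u) \<noteq> \<l> (\<phi> w)"
proof -
  let ?m = "card (C \<union> P \<union> Q)"
  obtain L where L: "M \<in> L" "I \<notin> L" "J \<notin> L"
    "2 * card {x \<in> V. \<l> x \<in> L} \<ge> ?m" "card {x \<in> V. \<l> x \<notin> L} \<ge> ?m"
    by (rule split_multipartite[OF V M MIJ(1,2)])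
  have fins: "finite A" "finite B" "finite Z" "finite P" "finite Q" using fin C(1) by auto
  have m: "?m = card A + card B + card Z + card P + card Q"
    using C disj fins by (simp add: card_Un_disjoint Int_Un_distrib2)
  have cC: "card C = card A + card B + card Z"
    using C fins by (simp add: card_Un_disjoint Int_Un_distrib2)
  obtain a where a: "a ` A \<subseteq> {x \<in> V. \<l> x = M}" "inj_on a A"
    using card_le_inj[of A "{x \<in> V. \<l> x = M}"] fins V(1) J M[of J] cC by auto
  obtain b where b: "b ` B \<subseteq> {x \<in> V. \<l> x = J}" "inj_on b B"
    using card_le_inj[of B "{x \<in> V. \<l> x = J}"] fins V(1) J cC by auto
  obtain z where z: "z ` Z \<subseteq> {x \<in> V. \<l> x = I}" "inj_on z Z"
    using card_le_inj[of Z "{x \<in> V. \<l> x = I}"] fins V(1) I by auto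
  let ?bz = "\<lambda>x. if x \<in> B then b x else z x"
  have cAP: "card (A \<union> P) \<le> card {x \<in> V. \<l> x \<in> L}"
    using card_Un_le[of A P] AB PQ L(4) m by linarith
  have imA: "a ` A \<subseteq> {x \<in> V. \<l> x \<in> L}" using a(1) L(1) by auto
  have finL: "finite {x \<in> V. \<l> x \<in> L}" "finite {x \<in> V. \<l> x \<notin> L}" using V(1) by auto
  obtain g where g: "inj_on g (A \<union> P)" "g ` (A \<union> P) \<subseteq> {x \<in> V. \<l> x \<in> L}" "\<forall>u\<in>A. g u = a u"
    by (rule inj_on_extend[OF finite_UnI[OF fins(1,4)] finL(1) Un_upper1 a(2) imA cAP])
  have bz: "inj_on ?bz (B \<union> Z)"
    by (rule inj_on_disjoint_Un[OF b(2) z(2)]) (use b(1) z(1) MIJ(3) in blast)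
  have "card (B \<union> Z \<union> Q) \<le> ?m" using fin C(1) by (intro card_mono) auto
  then have cQ: "card (B \<union> Z \<union> Q) \<le> card {x \<in> V. \<l> x \<notin> L}" using L(5) by linarith
  have imB: "?bz ` (B \<union> Z) \<subseteq> {x \<in> V. \<l> x \<notin> L}" using b z L(2,3) by auto
  have finQ: "finite (B \<union> Z \<union> Q)" using fins by simp
  obtain h where h: "inj_on h (B \<union> Z \<union> Q)" "h ` (B \<union> Z \<union> Q) \<subseteq> {x \<in> V. \<l> x \<notin> L}"
      "\<forall>u\<in>B \<union> Z. h u = ?bz u"
    by (rule inj_on_extend[OF finQ finL(2) Un_upper1 bz imB cQ])
  define \<phi> where "\<phi> u = (if u \<in> A \<union> P then g u else h u)" for u
  have out: "u \<notin> A \<union> P" if "u \<in> B \<union> Z \<union> Q" for u using that C disj by auto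
  have AP: "\<phi> u = g u" if "u \<in> A \<union> P" for u using that by (simp add: \<phi>_def)
  have BZQ: "\<phi> u = h u" if "u \<in> B \<union> Z \<union> Q" for u using out[OF that] by (simp add: \<phi>_def)
  have gL: "g u \<in> V \<and> \<l> (g u) \<in> L" if "u \<in> A \<union> P" for u using g(2) that by blast
  have hL: "h u \<in> V \<and> \<l> (h u) \<notin> L" if "u \<in> B \<union> Z \<union> Q" for u using h(2) that by blast
  have U: "C \<union> P \<union> Q = (A \<union> P) \<union> (B \<union> Z \<union> Q)" using C(1) by auto
  show ?thesis
  proof (rule that[of \<phi>])
    show "inj_on \<phi> (C \<union> P \<union> Q)"
      unfolding U \<phi>_def[abs_def] by (rule inj_on_disjoint_Un[OF g(1) h(1)]) (use g(2) h(2) in blast)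
    show "\<phi> ` (C \<union> P \<union> Q) \<subseteq> V" unfolding U using AP BZQ gL hL by fastforce
    show "\<l> (\<phi> u) = M" if "u \<in> A" for u using that AP[of u] g(3) a(1) by auto
    show "\<l> (\<phi> u) = J" if "u \<in> B" for u using that BZQ[of u] h(3) b(1) by auto
    show "\<l> (\<phi> u) = I" if "u \<in> Z" for u using that BZQ[of u] h(3) z(1) C(4) by auto
    show "\<l> (\<phi> u) \<noteq> \<l> (\<phi> w)" if "u \<in> P" "w \<in> Q" for u w
      using that AP[of u] BZQ[of w] gL[of u] hL[of w] by auto
  qed
qed

subsection \<open>Copies, colourings and components\<close>

lemma edge_cases:
  assumes "simple_graph G" "e \<in> edges G"
  obtains u v where "e = {u, v}" "u \<noteq> v" "u \<in> verts G" "v \<in> verts G"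
proof -
  have "e \<subseteq> verts G" "card e = 2" using assms by (auto simp: simple_graph_def nsets_def)
  then show ?thesis using that by (auto simp: card_2_iff)
qed

lemma edge_endpoints:
  assumes "simple_graph G" "{u, v} \<in> edges G"
  shows "u \<in> verts G" "v \<in> verts G" "u \<noteq> v"
proof -
  have "{u, v} \<subseteq> verts G" "card {u, v} = 2" using assms by (auto simp: simple_graph_def nsets_def)
  then show "u \<in> verts G" "v \<in> verts G" "u \<noteq> v" by auto
qed

lemma nonisolated_has_neighbour:
  assumes "simple_graph G" "u \<in> \<Union>(edges G)"
  obtains v where "{u, v} \<in> edges G"
proof -
  obtain e where e: "e \<in> edges G" "u \<in> e" using assms(2) by blast
  obtain a b where "e = {a, b}" "a \<noteq> b" "a \<in> verts G" "b \<in> verts G" by (rule edge_cases[OF assms(1) e(1)])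
  then show ?thesis using that[of a] that[of b] e by (auto simp: insert_commute)
qed

lemma edges_complete_graph: "edges (complete_graph n) = {{u, v} | u v. u < n \<and> v < n \<and> u \<noteq> v}"
proof -
  have "e \<in> [{..<n}]\<^bsup>2\<^esup> \<longleftrightarrow> (\<exists>u v. e = {u, v} \<and> u < n \<and> v < n \<and> u \<noteq> v)" for e
    by (auto simp: nsets_def card_2_iff)
  then show ?thesis by (auto simp: complete_graph_def)
qed

text \<open>A copy given by its injection is easier to build than a subgraph with an
  isomorphism.\<close>

definition mono_embeds :: "(nat set \<Rightarrow> nat) \<Rightarrow> nat \<Rightarrow> 'a graph \<Rightarrow> bool" where
  "mono_embeds c n H \<longleftrightarrow>
     (\<exists>\<phi> i. inj_on \<phi> (verts H) \<and> \<phi> ` verts H \<subseteq> {..<n} \<and> (\<forall>e\<in>edges H. c (\<phi> ` e) = i))"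

lemma mono_copy_iff_mono_embeds:
  assumes H: "simple_graph H"
  shows "(\<exists>F. copy_in H F (complete_graph n) \<and> monochromatic_graph c F) \<longleftrightarrow> mono_embeds c n H"
proof
  assume "\<exists>F. copy_in H F (complete_graph n) \<and> monochromatic_graph c F"
  then obtain F \<phi> i where F: "subgraph F (complete_graph n)" "bij_betw \<phi> (verts H) (verts F)"
      "edges F = (\<lambda>e. \<phi> ` e) ` edges H" "\<forall>e\<in>edges F. c e = i"
    by (auto simp: copy_in_def isomorphic_def monochromatic_graph_def)
  then show "mono_embeds c n H"
    unfolding mono_embeds_def
    by (intro exI[of _ \<phi>] exI[of _ i]) (auto simp: bij_betw_def subgraph_def complete_graph_def)
next
  assume "mono_embeds c n H"
  then obtain \<phi> i where \<phi>: "inj_on \<phi> (verts H)" "\<phi> ` verts H \<subseteq> {..<n}" "\<forall>e\<in>edges H. c (\<phi> ` e) = i"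
    by (auto simp: mono_embeds_def)
  let ?F = "Graph (\<phi> ` verts H) ((\<lambda>e. \<phi> ` e) ` edges H)"
  have nsets: "\<phi> ` e \<in> [\<phi> ` verts H]\<^bsup>2\<^esup>" if "e \<in> edges H" for e
  proof -
    have e: "e \<subseteq> verts H" "finite e" "card e = 2"
      using H that by (auto simp: simple_graph_def nsets_def)
    then show ?thesis
      using card_image[OF inj_on_subset[OF \<phi>(1) e(1)]] by (auto simp: nsets_def)
  qed
  have "edges ?F \<subseteq> [{..<n}]\<^bsup>2\<^esup>" using nsets nsets_mono[OF \<phi>(2), of 2] by auto
  then have "subgraph ?F (complete_graph n)"
    using H nsets \<phi>(2) by (auto simp: subgraph_def simple_graph_def complete_graph_def)
  moreover have "isomorphic H ?F"
    using \<phi>(1) by (auto simp: isomorphic_def bij_betw_def)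
  ultimately show "\<exists>F. copy_in H F (complete_graph n) \<and> monochromatic_graph c F"
    using \<phi>(3) by (intro exI[of _ ?F]) (auto simp: copy_in_def monochromatic_graph_def)
qed

lemma edges_path_graph_5: "edges (path_graph 5) = {{0, 1}, {1, 2}, {2, 3}, {3, 4}}"
proof -
  have "edges (path_graph 5) = (\<lambda>i. {i, Suc i}) ` {..<4}"
    by (auto simp: path_graph_def)
  also have "{..<4} = {0, 1, 2, 3::nat}" by auto
  finally show ?thesis by (simp add: numeral_eq_Suc)
qed

lemma card_edges_path_graph_5: "card (edges (path_graph 5)) = 4"
  by (simp add: edges_path_graph_5 doubleton_eq_iff)

lemma no_rainbow_P5_if_three_colours:
  assumes "c ` edges (complete_graph n) \<subseteq> {1..3}"
  shows "\<not> (\<exists>F. copy_in (path_graph 5) F (complete_graph n) \<and> rainbow_graph c F)"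
proof
  assume "\<exists>F. copy_in (path_graph 5) F (complete_graph n) \<and> rainbow_graph c F"
  then obtain F \<phi> where F: "subgraph F (complete_graph n)" "bij_betw \<phi> (verts (path_graph 5)) (verts F)"
      "edges F = (\<lambda>e. \<phi> ` e) ` edges (path_graph 5)" "inj_on c (edges F)"
    by (auto simp: copy_in_def isomorphic_def rainbow_graph_def)
  have "inj_on \<phi> {..<5}" using F(2) by (auto simp: bij_betw_def path_graph_def)
  then have "inj_on (\<lambda>e. \<phi> ` e) (Pow {..<5})" by (rule inj_on_image_Pow)
  then have "inj_on (\<lambda>e. \<phi> ` e) (edges (path_graph 5))"
    by (rule inj_on_subset) (auto simp: edges_path_graph_5)
  then have "card (edges F) = 4"
    using F(3) card_image card_edges_path_graph_5 by metis
  moreover have "c ` edges F \<subseteq> {1..3}" using F(1) assms by (auto simp: subgraph_def)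
  then have "card (c ` edges F) \<le> card {1..3::nat}" by (intro card_mono) auto
  ultimately show False using card_image[OF F(4)] by simp
qed

lemma rainbow_P5_I:
  assumes d: "distinct [a, b, x, y, z]" and lt: "{a, b, x, y, z} \<subseteq> {..<n}"
    and col: "distinct [c {a, b}, c {b, x}, c {x, y}, c {y, z}]"
  shows "\<exists>F. copy_in (path_graph 5) F (complete_graph n) \<and> rainbow_graph c F"
proof -
  let ?F = "Graph {a, b, x, y, z} {{a, b}, {b, x}, {x, y}, {y, z}}"
  let ?\<phi> = "\<lambda>i. [a, b, x, y, z] ! i"
  have five: "{..<5} = {0, 1, 2, 3, 4::nat}" by auto
  have "subgraph ?F (complete_graph n)"
    using d lt by (auto simp: subgraph_def simple_graph_def complete_graph_def nsets_def)
  moreover have "bij_betw ?\<phi> (verts (path_graph 5)) (verts ?F)"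
    unfolding bij_betw_def path_graph_def graph.sel five using d
    by (auto simp: inj_on_def)
  moreover have "edges ?F = (\<lambda>e. ?\<phi> ` e) ` edges (path_graph 5)"
    by (simp add: edges_path_graph_5)
  ultimately have "copy_in (path_graph 5) ?F (complete_graph n)"
    unfolding copy_in_def isomorphic_def by blast
  moreover have "rainbow_graph c ?F" using col by (auto simp: rainbow_graph_def)
  ultimately show ?thesis by blast
qed

text \<open>Guarantees that the \<open>LEAST\<close> in \<open>chromatic_number\<close> is
  attained.\<close>

lemma proper_coloring_exists:
  assumes "simple_graph G"
  shows "\<exists>k c. proper_coloring G k c"
proof -
  have fin: "finite (verts G)" using assms by (simp add: simple_graph_def)
  obtain c :: "'a \<Rightarrow> nat" where c: "inj_on c (verts G)" using finite_imp_inj_to_nat_seg[OF fin] by blast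
  have "proper_coloring G (Suc (Max (c ` verts G))) c"
    unfolding proper_coloring_def
  proof (intro conjI allI impI)
    show "c ` verts G \<subseteq> {..<Suc (Max (c ` verts G))}" using fin by (auto simp: less_Suc_eq_le)
    show "c u \<noteq> c v" if "{u, v} \<in> edges G" for u v
      using edge_endpoints[OF assms that] inj_onD[OF c] by blast
  qed
  then show ?thesis by blast
qed

lemma proper_coloring_chromatic_number:
  assumes "simple_graph G"
  shows "\<exists>c. proper_coloring G (chromatic_number G) c"
  unfolding chromatic_number_def using proper_coloring_exists[OF assms] by (rule LeastI_ex)

lemma chromatic_number_le: "proper_coloring G k c \<Longrightarrow> chromatic_number G \<le> k"
  unfolding chromatic_number_def by (rule Least_le) blast

lemma proper_coloring_mono: "proper_coloring G k c \<Longrightarrow> k \<le> l \<Longrightarrow> proper_coloring G l c"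
  by (auto simp: proper_coloring_def)

lemma chromatic_surplus_attained:
  assumes "simple_graph G" "chromatic_number G > 0"
  obtains c i where "proper_coloring G (chromatic_number G) c" "i < chromatic_number G"
    "card (color_class G c i) = chromatic_surplus G"
proof -
  let ?Q = "\<lambda>s. \<exists>c. proper_coloring G (chromatic_number G) c \<and>
        s = Min ((\<lambda>i. card (color_class G c i)) ` {..<chromatic_number G})"
  have "\<exists>s. ?Q s" using proper_coloring_chromatic_number[OF assms(1)] by blast
  then have "?Q (chromatic_surplus G)" unfolding chromatic_surplus_def by (rule LeastI_ex)
  then obtain c where c: "proper_coloring G (chromatic_number G) c"
    "chromatic_surplus G = Min ((\<lambda>i. card (color_class G c i)) ` {..<chromatic_number G})" by blast
  have "Min ((\<lambda>i. card (color_class G c i)) ` {..<chromatic_number G})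
      \<in> (\<lambda>i. card (color_class G c i)) ` {..<chromatic_number G}"
    using assms(2) by (intro Min_in) auto
  then show ?thesis using that c by auto
qed

lemma component_subset_verts:
  assumes "simple_graph G" "v \<in> verts G"
  shows "(adjacency G)\<^sup>* `` {v} \<subseteq> verts G"
proof
  fix u assume "u \<in> (adjacency G)\<^sup>* `` {v}"
  then have "(v, u) \<in> (adjacency G)\<^sup>*" by simp
  then show "u \<in> verts G"
  proof (induction rule: rtrancl_induct)
    case base then show ?case using assms by simp
  next
    case (step y z)
    then have "{y, z} \<in> edges G" by (simp add: adjacency_def)
    then show ?case using assms(1) by (auto simp: simple_graph_def nsets_def)
  qed
qed

lemma simple_graph_induced_subgraph:
  assumes "simple_graph G" "S \<subseteq> verts G"
  shows "simple_graph (induced_subgraph G S)"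
  using assms finite_subset[OF assms(2)]
  by (auto simp: simple_graph_def induced_subgraph_def nsets_def)

text \<open>A 3-colouring of \<open>H\<close> restricts to each component, so a component other than
  \<open>C0\<close> needs at most two colours. The 2-colourings of these components can be glued
  because no edge leaves a component.\<close>

lemma two_colouring_off_unique_component:
  assumes H: "simple_graph H" "chromatic_number H = 3"
    and uniq: "\<exists>!C. C \<in> components H \<and> chromatic_number C = 3"
  obtains C0 h where "C0 \<in> components H" "chromatic_number C0 = 3"
    "\<And>u. h u < (2::nat)" "\<And>u v. \<lbrakk>{u, v} \<in> edges H; u \<notin> verts C0\<rbrakk> \<Longrightarrow> h u \<noteq> h v"
proof -
  obtain C0 where C0: "C0 \<in> components H" "chromatic_number C0 = 3"
    and only: "\<And>C. \<lbrakk>C \<in> components H; chromatic_number C = 3\<rbrakk> \<Longrightarrow> C = C0"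
    using uniq by blast
  let ?K = "\<lambda>v. induced_subgraph H ((adjacency H)\<^sup>* `` {v})"
  obtain g where g: "proper_coloring H 3 g" using proper_coloring_chromatic_number[OF H(1)] H(2) by auto
  have two: "\<exists>c. proper_coloring C 2 c" if C: "C \<in> components H" "C \<noteq> C0" for C
  proof -
    obtain v where v: "v \<in> verts H" "C = ?K v" using C(1) by (auto simp: components_def)
    have sub: "(adjacency H)\<^sup>* `` {v} \<subseteq> verts H" using component_subset_verts[OF H(1) v(1)] .
    have "simple_graph C" unfolding v(2) using simple_graph_induced_subgraph[OF H(1) sub] .
    then obtain c where c: "proper_coloring C (chromatic_number C) c"
      using proper_coloring_chromatic_number by blast
    have "proper_coloring C 3 g"
      using g sub unfolding v(2) by (auto simp: proper_coloring_def induced_subgraph_def)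
    then have "chromatic_number C \<le> 3" by (rule chromatic_number_le)
    moreover have "chromatic_number C \<noteq> 3" using only[OF C(1)] C(2) by blast
    ultimately have "chromatic_number C \<le> 2" by simp
    then show ?thesis using proper_coloring_mono[OF c] by blast
  qed
  define k where "k C = (SOME c. proper_coloring C 2 c)" for C :: "'a graph"
  have k: "proper_coloring C 2 (k C)" if "C \<in> components H" "C \<noteq> C0" for C
    unfolding k_def using two[OF that] by (rule someI_ex)
  \<comment> \<open>\<open>mod 2\<close> keeps \<open>h\<close> below 2 everywhere, also on
    \<open>C0\<close>, where \<open>k\<close> is an arbitrary choice.\<close>
  define h where "h u = k (?K u) u mod 2" for u
  have "h u \<noteq> h v" if uv: "{u, v} \<in> edges H" "u \<notin> verts C0" for u v
  proof -
    have verts: "u \<in> verts H" using edge_endpoints[OF H(1) uv(1)] by simp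
    have adj: "(u, v) \<in> adjacency H" "(v, u) \<in> adjacency H"
      using uv(1) by (auto simp: adjacency_def insert_commute)
    then have "(adjacency H)\<^sup>* `` {u} = (adjacency H)\<^sup>* `` {v}"
      by (auto intro: converse_rtrancl_into_rtrancl)
    then have same: "?K v = ?K u" by simp
    have uu: "u \<in> verts (?K u)" "{u, v} \<in> edges (?K u)" "v \<in> verts (?K u)"
      using uv(1) adj by (auto simp: induced_subgraph_def)
    have "?K u \<in> components H" using verts by (auto simp: components_def)
    moreover have "?K u \<noteq> C0" using uu(1) uv(2) by blast
    ultimately have "proper_coloring (?K u) 2 (k (?K u))" by (rule k)
    then have "k (?K u) u \<noteq> k (?K u) v" "k (?K u) u < 2" "k (?K u) v < 2"
      using uu by (auto simp: proper_coloring_def)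
    then show ?thesis by (simp add: h_def same)
  qed
  then show ?thesis using that[of C0 h] C0 by (simp add: h_def)
qed

subsection \<open>Monochromatic copies of 3-chromatic graphs\<close>

text \<open>Isolated vertices of \<open>H\<close> carry no edge and can be sent to any free
  vertices.\<close>

lemma mono_embeds_if_nonisolated_embed:
  assumes H: "simple_graph H" and n: "card (verts H) \<le> n"
    and \<phi>: "inj_on \<phi> (\<Union>(edges H))" "\<phi> ` \<Union>(edges H) \<subseteq> {..<n}"
    and mono: "\<And>e. e \<in> edges H \<Longrightarrow> c (\<phi> ` e) = i"
  shows "mono_embeds c n H"
proof -
  have fin: "finite (verts H)" and sub: "\<Union>(edges H) \<subseteq> verts H"
    using H by (auto simp: simple_graph_def nsets_def)
  have "card (verts H) \<le> card {..<n}" using n by simp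
  then obtain h where h: "inj_on h (verts H)" "h ` verts H \<subseteq> {..<n}" "\<forall>a\<in>\<Union>(edges H). h a = \<phi> a"
    by (rule inj_on_extend[OF fin finite_lessThan sub \<phi>])
  have "c (h ` e) = i" if e: "e \<in> edges H" for e
  proof -
    have "h ` e = \<phi> ` e" using h(3) e by (intro image_cong) auto
    then show ?thesis using mono[OF e] by simp
  qed
  then show ?thesis using h(1,2) unfolding mono_embeds_def by blast
qed

section \<open>Complete graphs with the three-colour Ramsey property for \<open>H\<close>\<close>

context
  fixes H :: "'a graph" and n :: nat
  assumes H: "simple_graph H" "chromatic_number H = 3"
    and three_arrow: "\<And>c. range c \<subseteq> {1..3} \<Longrightarrow> mono_embeds c n H"
begin

lemma not_two_colourable: "\<not> proper_coloring H 2 k"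
  using chromatic_number_le[of H 2 k] H(2) by auto

lemma card_verts_le: "card (verts H) \<le> n"
proof -
  have "mono_embeds (\<lambda>_. 1) n H" by (rule three_arrow) auto
  then show ?thesis using card_inj_on_le[of _ "verts H" "{..<n}"] by (auto simp: mono_embeds_def)
qed

text \<open>Colouring an edge of \<open>K\<^sub>8\<close> by the highest binary digit in which its ends differ makes all three
  colour classes bipartite.\<close>

lemma three_arrow_ge_9: "n \<ge> 9"
proof (rule ccontr)
  assume "\<not> ?thesis"
  then have n: "n \<le> 8" by simp
  define c where "c e = (if \<exists>u\<in>e. \<exists>v\<in>e. u div 4 \<noteq> v div 4 then 1
    else if \<exists>u\<in>e. \<exists>v\<in>e. u div 2 \<noteq> v div 2 then 2 else 3 :: nat)" for e :: "nat set"
  have c: "c {x, y} = (if x div 4 \<noteq> y div 4 then 1 else if x div 2 \<noteq> y div 2 then 2 else 3)" for x y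
    by (auto simp: c_def)
  have halves: "a = b" if "a div 2 = b div 2" "a mod 2 = b mod 2" for a b :: nat
    using that by (metis div_mult_mod_eq)
  have quarters: "x div 4 = x div 2 div 2" for x :: nat by (simp add: div_mult2_eq[symmetric])
  have "mono_embeds c n H" by (rule three_arrow) (auto simp: c_def)
  then obtain \<phi> i where \<phi>: "inj_on \<phi> (verts H)" "\<phi> ` verts H \<subseteq> {..<n}" "\<And>e. e \<in> edges H \<Longrightarrow> c (\<phi> ` e) = i"
    by (auto simp: mono_embeds_def)
  define k where "k u = (if i = 1 then \<phi> u div 4 else if i = 2 then (\<phi> u div 2) mod 2 else \<phi> u mod 2)" for u
  have "proper_coloring H 2 k"
    unfolding proper_coloring_def
  proof (intro conjI allI impI)
    have "\<phi> u < 8" if "u \<in> verts H" for u using \<phi>(2) that n by auto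
    then have "\<phi> u div 4 < 2" if "u \<in> verts H" for u using that by fastforce
    then show "k ` verts H \<subseteq> {..<2}" by (auto simp: k_def)
    show "k u \<noteq> k v" if uv: "{u, v} \<in> edges H" for u v
    proof -
      have "\<phi> u \<noteq> \<phi> v" using edge_endpoints[OF H(1) uv] inj_onD[OF \<phi>(1)] by blast
      moreover have "c {\<phi> u, \<phi> v} = i" using \<phi>(3)[OF uv] by simp
      ultimately show ?thesis using halves[of "\<phi> u" "\<phi> v"] halves[of "\<phi> u div 2" "\<phi> v div 2"]
        unfolding c k_def by (auto simp: quarters split: if_splits)
    qed
  qed
  then show False using not_two_colourable by blast
qed

text \<open>Otherwise the vertices split into two halves, each smaller than the set of non-isolated
  vertices of \<open>H\<close>. Colour 1 between the halves is bipartite, and colours 2 and 3 each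
  live inside one half, which is too small.\<close>

lemma three_arrow_ge_twice_nonisolated: "n + 1 \<ge> 2 * card (\<Union>(edges H))"
proof (rule ccontr)
  assume neg: "\<not> ?thesis"
  define m where "m = card (\<Union>(edges H)) - 1"
  have m: "n \<le> 2 * m" "card (\<Union>(edges H)) = Suc m" using neg by (auto simp: m_def)
  define c where "c e = (if \<exists>u\<in>e. \<exists>v\<in>e. u < m \<and> \<not> v < m then 1
    else if \<forall>u\<in>e. u < m then 2 else 3 :: nat)" for e :: "nat set"
  have c: "c {x, y} = (if (x < m) \<noteq> (y < m) then 1 else if x < m then 2 else 3)" for x y
    by (auto simp: c_def)
  have "mono_embeds c n H" by (rule three_arrow) (auto simp: c_def)
  then obtain \<phi> i where \<phi>: "inj_on \<phi> (verts H)" "\<phi> ` verts H \<subseteq> {..<n}" "\<And>e. e \<in> edges H \<Longrightarrow> c (\<phi> ` e) = i"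
    by (auto simp: mono_embeds_def)
  have i: "c {\<phi> u, \<phi> v} = i" if "{u, v} \<in> edges H" for u v using \<phi>(3)[OF that] by simp
  have sub: "\<Union>(edges H) \<subseteq> verts H" using H(1) by (auto simp: simple_graph_def nsets_def)
  have inj: "inj_on \<phi> (\<Union>(edges H))" using inj_on_subset[OF \<phi>(1) sub] .
  consider "i = 1" | "i = 2" | "i \<noteq> 1" "i \<noteq> 2" by blast
  then show False
  proof cases
    case 1
    have "proper_coloring H 2 (\<lambda>u. if \<phi> u < m then 0 else 1)"
      unfolding proper_coloring_def
    proof (intro conjI allI impI)
      fix u v assume "{u, v} \<in> edges H"
      from i[OF this] 1 show "(if \<phi> u < m then 0 else 1) \<noteq> (if \<phi> v < m then 0 else 1 :: nat)"
        by (cases "\<phi> u < m"; cases "\<phi> v < m") (simp_all add: c)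
    qed auto
    then show False using not_two_colourable by blast
  next
    case 2
    have "\<phi> u < m" if u: "u \<in> \<Union>(edges H)" for u
    proof -
      obtain v where v: "{u, v} \<in> edges H" using nonisolated_has_neighbour[OF H(1) u] .
      from i[OF v] 2 show ?thesis by (cases "\<phi> u < m"; cases "\<phi> v < m") (simp_all add: c)
    qed
    then have "\<phi> ` \<Union>(edges H) \<subseteq> {..<m}" by blast
    from card_inj_on_le[OF inj this] show False using m(2) by simp
  next
    case 3
    have ge: "m \<le> \<phi> u" if u: "u \<in> \<Union>(edges H)" for u
    proof -
      obtain v where v: "{u, v} \<in> edges H" using nonisolated_has_neighbour[OF H(1) u] .
      from i[OF v] 3 show ?thesis by (cases "\<phi> u < m"; cases "\<phi> v < m") (simp_all add: c)
    qed
    have "\<phi> ` \<Union>(edges H) \<subseteq> {m..<n}"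
    proof (rule image_subsetI)
      fix u assume u: "u \<in> \<Union>(edges H)"
      have "\<phi> u < n" using u sub \<phi>(2) by blast
      then show "\<phi> u \<in> {m..<n}" using ge[OF u] by simp
    qed
    from card_inj_on_le[OF inj this] show False using m by simp
  qed
qed

text \<open>By \<open>dom\<close> each vertex sees at most one colour besides \<open>D\<close>,
  which becomes its label. Edges between differently labelled vertices have colour \<open>D\<close>,
  so an embedding that gives the ends of every edge of \<open>H\<close> different labels is
  monochromatic.\<close>

lemma mono_embeds_if_dominant_colour:
  assumes uniq: "\<exists>!C. C \<in> components H \<and> chromatic_number C = 3"
    and big: "\<forall>C \<in> components H. card (verts C) \<ge> chromatic_surplus H"
    and dom: "\<And>u v w. \<lbrakk>u < n; v < n; w < n; u \<noteq> v; u \<noteq> w; c {u, v} \<noteq> D; c {u, w} \<noteq> D\<rbrakk>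
      \<Longrightarrow> c {u, v} = c {u, w}"
  shows "mono_embeds c n H"
proof (rule ccontr)
  assume no_mono: "\<not> mono_embeds c n H"
  obtain C0 h where C0: "C0 \<in> components H" "chromatic_number C0 = 3"
    and h: "\<And>u. h u < (2::nat)" "\<And>u v. \<lbrakk>{u, v} \<in> edges H; u \<notin> verts C0\<rbrakk> \<Longrightarrow> h u \<noteq> h v"
    using two_colouring_off_unique_component[OF H uniq] by metis
  obtain g i0 where g: "proper_coloring H 3 g" "i0 < 3" "card (color_class H g i0) = chromatic_surplus H"
    using chromatic_surplus_attained[OF H(1)] H(2) by auto
  let ?K = "\<lambda>v. induced_subgraph H ((adjacency H)\<^sup>* `` {v})"
  let ?U = "\<Union>(edges H)"
  have sub: "?U \<subseteq> verts H" and finH: "finite (verts H)"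
    using H(1) by (auto simp: simple_graph_def nsets_def)
  obtain v0 where v0: "v0 \<in> verts H" "C0 = ?K v0" using C0(1) by (auto simp: components_def)
  have vC0: "verts C0 = (adjacency H)\<^sup>* `` {v0}" unfolding v0(2) by (simp add: induced_subgraph_def)
  have closed: "v \<in> verts C0" if "{u, v} \<in> edges H" "u \<in> verts C0" for u v
    using that unfolding vC0 by (auto simp: adjacency_def intro: rtrancl_into_rtrancl)
  have "edges C0 \<noteq> {}"
  proof
    assume "edges C0 = {}"
    then have "proper_coloring C0 1 (\<lambda>_. 0)" by (auto simp: proper_coloring_def)
    then show False using chromatic_number_le[of C0 1] C0(2) by fastforce
  qed
  then obtain e0 where e0: "e0 \<in> edges H" "e0 \<subseteq> verts C0"
    unfolding v0(2) by (auto simp: induced_subgraph_def)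

  \<comment> \<open>The vertices incident only with \<open>D\<close> form the part labelled \<open>D\<close>.\<close>
  define \<l> where "\<l> x = (if \<exists>y<n. y \<noteq> x \<and> c {x, y} \<noteq> D
    then c {x, SOME y. y < n \<and> y \<noteq> x \<and> c {x, y} \<noteq> D} else D)" for x
  \<comment> \<open>By \<open>dom\<close> the vertex picked by \<open>SOME\<close> does not
    influence the label.\<close>
  have l: "\<l> x = c {x, y}" if "x < n" "y < n" "x \<noteq> y" "c {x, y} \<noteq> D" for x y
  proof -
    let ?y = "SOME y. y < n \<and> y \<noteq> x \<and> c {x, y} \<noteq> D"
    have ex: "\<exists>y<n. y \<noteq> x \<and> c {x, y} \<noteq> D" using that by auto
    then have "?y < n \<and> ?y \<noteq> x \<and> c {x, ?y} \<noteq> D" by (rule someI_ex)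
    then show ?thesis using dom[of x ?y y] that ex by (simp add: \<l>_def)
  qed
  let ?part = "\<lambda>a. {x \<in> {..<n}. \<l> x = a}"
  have "card (?part a) \<le> card {..<n}" for a by (intro card_mono) auto
  then have "\<forall>a. True \<longrightarrow> card (?part a) < Suc n" by (simp add: less_Suc_eq_le)
  then obtain M where M: "\<And>a. card (?part a) \<le> card (?part M)"
    using ex_has_greatest_nat[of "\<lambda>_. True" _ "\<lambda>a. card (?part a)" "Suc n"] by blast

  \<comment> \<open>Colours 1 and 2 of \<open>c'\<close> each stand for a single colour of
    \<open>c\<close>, so \<open>no_mono\<close> excludes a copy in either; the copy found has the
    merged colour 3.\<close>
  define c' where "c' e = (if c e = D then 1 else if c e = M then 2 else 3 :: nat)" for e
  have "mono_embeds c' n H" by (rule three_arrow) (auto simp: c'_def)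
  then obtain \<phi> i where \<phi>: "inj_on \<phi> (verts H)" "\<phi> ` verts H \<subseteq> {..<n}" "\<And>e. e \<in> edges H \<Longrightarrow> c' (\<phi> ` e) = i"
    by (auto simp: mono_embeds_def)
  have not_mono: "\<exists>e\<in>edges H. c (\<phi> ` e) \<noteq> a" for a
    using no_mono \<phi>(1,2) unfolding mono_embeds_def by blast
  have i: "i = 3"
  proof -
    obtain e1 e2 where "e1 \<in> edges H" "c (\<phi> ` e1) \<noteq> D" "e2 \<in> edges H" "c (\<phi> ` e2) \<noteq> M"
      using not_mono by metis
    then show ?thesis using \<phi>(3)[of e1] \<phi>(3)[of e2] by (auto simp: c'_def split: if_splits)
  qed
  have third: "c (\<phi> ` e) \<noteq> D" "c (\<phi> ` e) \<noteq> M" if "e \<in> edges H" for e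
    using \<phi>(3)[OF that] i by (auto simp: c'_def split: if_splits)
  have lt: "\<phi> u < n" if "u \<in> verts H" for u using \<phi>(2) that by blast
  have edge: "\<l> (\<phi> u) = c (\<phi> ` {u, v})" if uv: "{u, v} \<in> edges H" for u v
  proof -
    note uv' = edge_endpoints[OF H(1) uv]
    have "\<phi> u \<noteq> \<phi> v" using uv' inj_onD[OF \<phi>(1)] by blast
    then show ?thesis using l[of "\<phi> u" "\<phi> v"] third(1)[OF uv] lt uv' by simp
  qed
  \<comment> \<open>The colour of an edge of the copy is the label of both its ends, so every
    component of \<open>H\<close> lands in a single part.\<close>
  have conn: "\<l> (\<phi> u) = \<l> (\<phi> v)" if "(u, v) \<in> (adjacency H)\<^sup>*" for u v
    using that
  proof (induction rule: rtrancl_induct)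
    case (step y z)
    then have "{y, z} \<in> edges H" "{z, y} \<in> edges H" by (auto simp: adjacency_def insert_commute)
    then show ?case using step.IH edge[of y z] edge[of z y] by (simp add: insert_commute)
  qed simp

  define J where "J = \<l> (\<phi> v0)"
  have J: "\<l> (\<phi> u) = J" if "u \<in> verts C0" for u using conn[of v0 u] that by (simp add: vC0 J_def)
  obtain a b where ab: "e0 = {a, b}" "a \<noteq> b" "a \<in> verts H" "b \<in> verts H"
    by (rule edge_cases[OF H(1) e0(1)])
  have MJ: "M \<noteq> J" using edge[of a b] third(2)[OF e0(1)] J[of a] e0 ab by auto
  \<comment> \<open>The copy is not monochromatic for \<open>c\<close>, so some edge has a colour
    other than \<open>J\<close>; its component lies in another part \<open>I\<close>.\<close>
  obtain e1 where e1: "e1 \<in> edges H" "c (\<phi> ` e1) \<noteq> J" using not_mono by blast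
  obtain p q where pq: "e1 = {p, q}" "p \<noteq> q" "p \<in> verts H" "q \<in> verts H"
    by (rule edge_cases[OF H(1) e1(1)])
  define I where "I = \<l> (\<phi> p)"
  have Ie: "I = c (\<phi> ` e1)" using edge[of p q] e1(1) pq(1) by (simp add: I_def)
  have IJ: "I \<noteq> J" "M \<noteq> I" using Ie e1 third(2) by auto
  \<comment> \<open>The component of \<open>p\<close> lies inside part \<open>I\<close>, and
    \<open>big\<close> makes it large enough to leave room for the smallest colour class.\<close>
  have partI: "card (?part I) \<ge> chromatic_surplus H"
  proof -
    let ?S = "(adjacency H)\<^sup>* `` {p}"
    have S: "?S \<subseteq> verts H" using component_subset_verts[OF H(1) pq(3)] .
    have "?K p \<in> components H" using pq(3) by (auto simp: components_def)
    then have "chromatic_surplus H \<le> card (verts (?K p))" using big by blast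
    then have "chromatic_surplus H \<le> card ?S" by (simp add: induced_subgraph_def)
    also have "\<dots> \<le> card (?part I)"
      by (rule card_inj_on_le[OF inj_on_subset[OF \<phi>(1) S]]) (use S lt conn[of p] in \<open>auto simp: I_def\<close>)
    finally show ?thesis .
  qed
  have partJ: "card (?U \<inter> verts C0) \<le> card (?part J)"
    by (rule card_inj_on_le[OF inj_on_subset[OF \<phi>(1)]]) (use sub lt J in auto)
  \<comment> \<open>The non-isolated vertices of the copy all avoid part \<open>M\<close>, which
    gives the second room condition of \<open>embed_into_multipartite\<close>.\<close>
  have partM: "card ?U \<le> card ({..<n} - ?part M)"
  proof (rule card_inj_on_le[OF inj_on_subset[OF \<phi>(1) sub]])
    show "\<phi> ` ?U \<subseteq> {..<n} - ?part M"
    proof (rule image_subsetI)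
      fix u assume u: "u \<in> ?U"
      obtain v where v: "{u, v} \<in> edges H" using nonisolated_has_neighbour[OF H(1) u] .
      have "\<l> (\<phi> u) \<noteq> M" using edge[OF v] third(2)[OF v] by simp
      then show "\<phi> u \<in> {..<n} - ?part M" using lt sub u by auto
    qed
  qed simp

  \<comment> \<open>The classes keep only non-isolated vertices, whose number is what the bounds on
    \<open>n\<close> control.\<close>
  define A where "A k = {u \<in> ?U \<inter> verts C0. g u = k}" for k
  define P where "P k = {u \<in> ?U - verts C0. h u = k}" for k
  \<comment> \<open>\<open>i0\<close>, the colour that attains the surplus, is reserved for part
    \<open>I\<close>; the other two colours are ordered by size as
    \<open>embed_into_multipartite\<close> demands.\<close>
  obtain j k where jk: "j < 3" "k < 3" "distinct [i0, j, k]" "card (A j) \<le> card (A k)"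
  proof -
    define j k where "j = (i0 + 1) mod 3" and "k = (i0 + 2) mod 3"
    have "i0 = 0 \<or> i0 = 1 \<or> i0 = 2" using g(2) by auto
    then have "j < 3" "k < 3" "distinct [i0, j, k]" by (auto simp: j_def k_def)
    then show ?thesis using that[of j k] that[of k j] by fastforce
  qed
  have three: "x = i0 \<or> x = j \<or> x = k" if "x < 3" for x using that jk g(2) by auto
  obtain r s where rs: "{r, s} = {0, 1::nat}" "r \<noteq> s" "card (P r) \<le> card (P s)"
    using linear[of "card (P 0)" "card (P 1)"] by (metis insert_commute zero_neq_one)
  have two: "x = r \<or> x = s" if "x < 2" for x
  proof -
    have "x \<in> {0, 1}" using that by auto
    then show ?thesis unfolding rs(1)[symmetric] by simp
  qed
  have g3: "g u < 3" if "u \<in> ?U" for u using g(1) sub that by (auto simp: proper_coloring_def)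
  have C: "?U \<inter> verts C0 = A j \<union> A k \<union> A i0" using g3 three by (auto simp: A_def)
  have U: "?U = ?U \<inter> verts C0 \<union> P r \<union> P s" using h(1) two by (auto simp: P_def)
  have Z: "card (A i0) \<le> card (?part I)"
  proof -
    have "card (A i0) \<le> card (color_class H g i0)"
      using finH sub by (intro card_mono) (auto simp: A_def color_class_def)
    then show ?thesis using g(3) partI by linarith
  qed
  obtain \<psi> where \<psi>: "inj_on \<psi> (?U \<inter> verts C0 \<union> P r \<union> P s)"
    "\<psi> ` (?U \<inter> verts C0 \<union> P r \<union> P s) \<subseteq> {..<n}"
    "\<And>u. u \<in> A j \<Longrightarrow> \<l> (\<psi> u) = M" "\<And>u. u \<in> A k \<Longrightarrow> \<l> (\<psi> u) = J" "\<And>u. u \<in> A i0 \<Longrightarrow> \<l> (\<psi> u) = I"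
    "\<And>u w. \<lbrakk>u \<in> P r; w \<in> P s\<rbrakk> \<Longrightarrow> \<l> (\<psi> u) \<noteq> \<l> (\<psi> w)"
  proof (rule embed_into_multipartite[where V = "{..<n}" and \<l> = \<l> and M = M and I = I and J = J])
    show "2 * card (?U \<inter> verts C0 \<union> P r \<union> P s) \<le> card {..<n} + 1"
      unfolding U[symmetric] using three_arrow_ge_twice_nonisolated by simp
    show "card (?U \<inter> verts C0 \<union> P r \<union> P s) \<le> card ({..<n} - ?part M)"
      unfolding U[symmetric] by (rule partM)
    show "finite (?U \<inter> verts C0 \<union> P r \<union> P s)"
      unfolding U[symmetric] using finite_subset[OF sub finH] .
    show "?U \<inter> verts C0 = A j \<union> A k \<union> A i0" by (rule C)
    show "A j \<inter> A k = {}" "A j \<inter> A i0 = {}" "A k \<inter> A i0 = {}" using jk(3) by (auto simp: A_def)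
    show "?U \<inter> verts C0 \<inter> P r = {}" "?U \<inter> verts C0 \<inter> P s = {}" "P r \<inter> P s = {}"
      using rs(2) by (auto simp: P_def)
  qed (use M MJ IJ jk(4) rs(3) partJ Z in simp_all)
  have U_I: "u \<in> ?U" if "{u, v} \<in> edges H" for u v using that by blast
  have "mono_embeds c n H"
  proof (rule mono_embeds_if_nonisolated_embed[OF H(1) card_verts_le])
    show "inj_on \<psi> ?U" "\<psi> ` ?U \<subseteq> {..<n}" using \<psi>(1,2) unfolding U[symmetric] by auto
    fix e assume e: "e \<in> edges H"
    obtain u v where uv: "e = {u, v}" "u \<noteq> v" "u \<in> verts H" "v \<in> verts H"
      by (rule edge_cases[OF H(1) e])
    have uvE: "{u, v} \<in> edges H" "{v, u} \<in> edges H" using e uv(1) by (auto simp: insert_commute)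
    then have uvU: "u \<in> ?U" "v \<in> ?U" using U_I by blast+
    have "\<l> (\<psi> u) \<noteq> \<l> (\<psi> v)"
    proof (cases "u \<in> verts C0")
      case True
      then have v: "v \<in> verts C0" using closed uvE(1) by blast
      have ne: "g u \<noteq> g v" using g(1) uvE(1) by (auto simp: proper_coloring_def)
      have mem: "u \<in> A (g u)" "v \<in> A (g v)" using True v uvU by (auto simp: A_def)
      have lab: "\<l> (\<psi> w) = (if x = j then M else if x = k then J else I)"
        if "w \<in> A x" "x = i0 \<or> x = j \<or> x = k" for w x
        using that \<psi>(3-5) jk(3) by auto
      show ?thesis
        using lab[OF mem(1) three[OF g3[OF uvU(1)]]] lab[OF mem(2) three[OF g3[OF uvU(2)]]]
          three[OF g3[OF uvU(1)]] three[OF g3[OF uvU(2)]] ne MJ IJ by (auto split: if_splits)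
    next
      case False
      then have v: "v \<notin> verts C0" using closed uvE(2) by blast
      have ne: "h u \<noteq> h v" using h(2) uvE(1) False by blast
      have mem: "u \<in> P (h u)" "v \<in> P (h v)" using False v uvU by (auto simp: P_def)
      have "h u = r \<and> h v = s \<or> h u = s \<and> h v = r" using two[OF h(1)[of u]] two[OF h(1)[of v]] ne by auto
      then show ?thesis using mem \<psi>(6)[of u v] \<psi>(6)[of v u] by auto
    qed
    moreover have "\<psi> u < n" "\<psi> v < n" using \<psi>(2) uvU unfolding U[symmetric] by auto
    \<comment> \<open>An edge of another colour would give both its ends that colour as
      label.\<close>
    ultimately have "c {\<psi> u, \<psi> v} = D"
      using l[of "\<psi> u" "\<psi> v"] l[of "\<psi> v" "\<psi> u"] by (metis insert_commute)
    then show "c (\<psi> ` e) = D" using uv(1) by simp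
  qed
  then show False using no_mono by blast
qed

lemma mono_embeds_if_three_colours_used:
  assumes "card (c ` edges (complete_graph n)) \<le> 3"
  shows "mono_embeds c n H"
proof -
  let ?S = "c ` edges (complete_graph n)"
  have "finite ?S" by (simp add: complete_graph_def finite_imp_finite_nsets)
  then obtain k where k: "k ` ?S \<subseteq> {1..3::nat}" "inj_on k ?S"
    using card_le_inj[of ?S "{1..3::nat}"] assms by auto
  \<comment> \<open>Values that are not colours of edges are sent to 1, since
    \<open>three_arrow\<close> asks for a bound on the whole range.\<close>
  define c' where "c' e = (if c e \<in> ?S then k (c e) else 1)" for e
  have "mono_embeds c' n H" by (rule three_arrow) (use k(1) in \<open>auto simp: c'_def\<close>)
  then obtain \<phi> i where \<phi>: "inj_on \<phi> (verts H)" "\<phi> ` verts H \<subseteq> {..<n}" "\<And>e. e \<in> edges H \<Longrightarrow> c' (\<phi> ` e) = i"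
    by (auto simp: mono_embeds_def)
  have "c (\<phi> ` e) = the_inv_into ?S k i" if e: "e \<in> edges H" for e
  proof -
    obtain u v where uv: "e = {u, v}" "u \<noteq> v" "u \<in> verts H" "v \<in> verts H"
      by (rule edge_cases[OF H(1) e])
    then have "\<phi> u \<noteq> \<phi> v" "\<phi> u < n" "\<phi> v < n" using inj_onD[OF \<phi>(1)] \<phi>(2) by blast+
    then have "\<phi> ` e \<in> edges (complete_graph n)" using uv(1) by (auto simp: edges_complete_graph)
    then have S: "c (\<phi> ` e) \<in> ?S" by blast
    then have "k (c (\<phi> ` e)) = i" using \<phi>(3)[OF e] by (simp add: c'_def)
    then show ?thesis using the_inv_into_f_f[OF k(2) S] by simp
  qed
  then show ?thesis using \<phi>(1,2) unfolding mono_embeds_def by blast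
qed

text \<open>With \<open>m\<close> non-isolated vertices in \<open>H\<close>, the bounds
  \<open>n \<ge> 9\<close> and \<open>n + 1 \<ge> 2 * m\<close> give \<open>n - 4 \<ge> m\<close>:
  the first settles \<open>m \<le> 5\<close>, the second \<open>m \<ge> 5\<close>. So these vertices
  fit into \<open>K\<close>.\<close>

lemma mono_embeds_if_large_mono_clique:
  assumes K: "K \<subseteq> {..<n}" "card K + 4 \<ge> n" and mono: "\<forall>p\<in>K. \<forall>q\<in>K. p \<noteq> q \<longrightarrow> c {p, q} = \<gamma>"
  shows "mono_embeds c n H"
proof -
  have fin: "finite (\<Union>(edges H))" "finite K"
    using H(1) finite_subset[OF K(1)] by (auto simp: simple_graph_def nsets_def intro: finite_subset)
  have "card (\<Union>(edges H)) \<le> card K"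
    using three_arrow_ge_9 three_arrow_ge_twice_nonisolated K(2) by linarith
  then obtain \<phi> where \<phi>: "\<phi> ` \<Union>(edges H) \<subseteq> K" "inj_on \<phi> (\<Union>(edges H))"
    using card_le_inj[OF fin] by blast
  show ?thesis
  proof (rule mono_embeds_if_nonisolated_embed[OF H(1) card_verts_le \<phi>(2)])
    show "\<phi> ` \<Union>(edges H) \<subseteq> {..<n}" using \<phi>(1) K(1) by blast
    fix e assume e: "e \<in> edges H"
    obtain u v where uv: "e = {u, v}" "u \<noteq> v" "u \<in> verts H" "v \<in> verts H"
      by (rule edge_cases[OF H(1) e])
    then have U: "u \<in> \<Union>(edges H)" "v \<in> \<Union>(edges H)" using e by blast+
    have "\<phi> u \<noteq> \<phi> v" using inj_onD[OF \<phi>(2)] U uv(2) by blast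
    moreover have "\<phi> u \<in> K" "\<phi> v \<in> K" using U \<phi>(1) by blast+
    ultimately show "c (\<phi> ` e) = \<gamma>" using mono uv(1) by simp
  qed
qed

end

section \<open>Equality of the two Ramsey numbers\<close>

theorem theorem1p13:
  fixes H :: "'a graph"
  assumes "simple_graph H"
    and "chromatic_number H = 3"
    and "\<exists>!C. C \<in> components H \<and> chromatic_number C = 3"
    and "\<forall>C \<in> components H. card (verts C) \<ge> chromatic_surplus H"
  shows "constrained_ramsey H (path_graph 5) = multicolor_ramsey 3 H"
proof -
  let ?mono = "\<lambda>n c. \<exists>F. copy_in H F (complete_graph n) \<and> monochromatic_graph c F"
  let ?rain = "\<lambda>n c. \<exists>F. copy_in (path_graph 5) F (complete_graph n) \<and> rainbow_graph c F"
  have mono: "?mono n c \<or> ?rain n c"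
    if R: "\<forall>c. c ` edges (complete_graph n) \<subseteq> {1..3} \<longrightarrow> ?mono n c" for n c
  proof (rule ccontr)
    assume neg: "\<not> (?mono n c \<or> ?rain n c)"
    note embeds_iff = mono_copy_iff_mono_embeds[OF assms(1)]
    have no: "\<not> mono_embeds c n H" using neg unfolding embeds_iff by blast
    have arrow: "mono_embeds c n H" if "range c \<subseteq> {1..3}" for c
      using R that unfolding embeds_iff by blast
    note ctxt = assms(1,2) arrow
    interpret rainbow_P5_free "{..<n}" "\<lambda>u v. c {u, v}"
    proof
      show "\<not> distinct [c {a, b}, c {b, x}, c {x, y}, c {y, z}]"
        if "a \<in> {..<n}" "b \<in> {..<n}" "x \<in> {..<n}" "y \<in> {..<n}" "z \<in> {..<n}"
          "distinct [a, b, x, y, z]" for a b x y z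
        using rainbow_P5_I[of a b x y z n c] that neg by blast
    qed (simp_all add: insert_commute)
    have "(\<Union>u\<in>{..<n}. palette u) = c ` edges (complete_graph n)"
      by (auto simp: palette_def edges_complete_graph)
    then have "card (\<Union>u\<in>{..<n}. palette u) \<ge> 4"
      using mono_embeds_if_three_colours_used[OF ctxt, of c] no by fastforce
    moreover have "card {..<n} \<ge> 7" using three_arrow_ge_9[OF ctxt] by simp
    ultimately consider D where "\<forall>u\<in>{..<n}. \<forall>x\<in>palette u - {D}. \<forall>y\<in>palette u - {D}. x = y"
      | K where "mono_clique K" "card K + 4 \<ge> n"
      using dominant_colour_or_large_mono_clique by auto
    then show False
    proof cases
      case (1 D)
      have dom: "c {u, v} = c {u, w}"
        if "u < n" "v < n" "w < n" "u \<noteq> v" "u \<noteq> w" "c {u, v} \<noteq> D" "c {u, w} \<noteq> D" for u v w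
      proof -
        have "c {u, v} \<in> palette u - {D}" "c {u, w} \<in> palette u - {D}"
          using palette_I[of v u] palette_I[of w u] that by simp_all
        then show ?thesis using 1 that(1) by blast
      qed
      have "mono_embeds c n H"
        by (rule mono_embeds_if_dominant_colour[OF ctxt assms(3,4)]) (auto intro: dom)
      then show False using no by blast
    next
      case (2 K)
      then obtain \<gamma> where \<gamma>: "K \<subseteq> {..<n}" "\<forall>p\<in>K. \<forall>q\<in>K. p \<noteq> q \<longrightarrow> c {p, q} = \<gamma>"
        unfolding mono_clique_def by blast
      have "mono_embeds c n H" by (rule mono_embeds_if_large_mono_clique[OF ctxt \<gamma>(1) 2(2) \<gamma>(2)])
      then show False using no by blast
    qed
  qed
  \<comment> \<open>The two defining properties hold for the same \<open>n\<close>, so the two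
    \<open>LEAST\<close> terms coincide.\<close>
  have "(\<forall>c. ?mono n c \<or> ?rain n c) \<longleftrightarrow>
      (\<forall>c. c ` edges (complete_graph n) \<subseteq> {1..3} \<longrightarrow> ?mono n c)" for n
  proof (intro iffI allI impI)
    fix c :: "nat set \<Rightarrow> nat"
    assume "\<forall>c. ?mono n c \<or> ?rain n c" "c ` edges (complete_graph n) \<subseteq> {1..3}"
    then show "?mono n c" using no_rainbow_P5_if_three_colours[of c n] by blast
  qed (rule mono)
  then show ?thesis unfolding constrained_ramsey_def multicolor_ramsey_def by simp
qed

end
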